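(* Let $d\ge1$, $a>0$, $b\in\mathbb{R}^d$, $\sigma=\sqrt{2a}$, $\varsigma\in(0,1]$, and let $D\subset\mathbb{R}^d$ be a nonempty bounded open set. For each $x\in D$, the sequence $(Y^x_\varsigma(n))_n$ converges almost surely to a (random) point $Y^x_\varsigma(\infty)\in\partial D$.
   Context: Notation: $d(x,G)=\inf\{\|x-y\|:y\in G\}$ with $\|\cdot\|$ the Euclidean norm; $B_r(x)$ is the open Euclidean ball. The process: $X^x_t=x+bt+\sigma W_t$, $t\ge0$, where $W$ is a standard $d$-dimensional Brownian motion started at $0$ on a probability space $(\Omega,\mathcal F,\mathbb P)$. For $r\ge 0$ put $\tau^X(B_r(x))=\inf\{t>0:X^x_t\notin B_r(x)\}$ (so for $r=0$ this time is $0$). The sequence: for $x\in D$, $Y^x_\varsigma(1)=x$ and, for $n\ge1$, $Y^x_\varsigma(n+1)=X^{Y^x_\varsigma(n)}_{\tau^X(B_{r_n}(Y^x_\varsigma(n)))}$ with $r_n=\varsigma\, d(Y^x_\varsigma(n),\partial D)$. That is, at each step the process is started afresh at $Y^x_\varsigma(n)$, independently of the past given $Y^x_\varsigma(n)$, and stopped when it first leaves $B_{r_n}(Y^x_\varsigma(n))$. Thus $(Y^x_\varsigma(n))_n$ is a Markov chain whose transition law from $y\in\overline D$ is the law of $X^y_{\tau^X(B_{\varsigma d(y,\partial D)}(y))}$, and $\|Y^x_\varsigma(n+1)-Y^x_\varsigma(n)\|=\varsigma\,d(Y^x_\varsigma(n),\partial D)$. *)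

theory Defs
  imports "HOL-Probability.Probability"
begin

text \<open>\<open>prob_space.indep_var\<close> only relates random variables with values in the same type; this is its
  counterpart for two value types.\<close>

definition indep_rvs ::
  "'w measure \<Rightarrow> 'b measure \<Rightarrow> ('w \<Rightarrow> 'b) \<Rightarrow> 'c measure \<Rightarrow> ('w \<Rightarrow> 'c) \<Rightarrow> bool" where
  "indep_rvs M N X N' Y \<longleftrightarrow>
     X \<in> measurable M N \<and> Y \<in> measurable M N' \<and>
     prob_space.indep_set M
       {X -` A \<inter> space M | A. A \<in> sets N} {Y -` B \<inter> space M | B. B \<in> sets N'}"

text \<open>The component-wise product of one-dimensional normal densities is the density of
  \<open>N(0, (t - s) I)\<close> on \<open>real ^ 'd\<close> (the parameter of \<open>normal_density\<close> is the standard
  deviation). As usual, \<open>W\<close> starts at 0 and has continuous paths up to a null event.\<close>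

definition standard_brownian_motion ::
  "'w measure \<Rightarrow> (real \<Rightarrow> 'w \<Rightarrow> real ^ 'd) \<Rightarrow> bool" where
  "standard_brownian_motion M W \<longleftrightarrow>
     prob_space M \<and>
     (\<forall>t\<ge>0. W t \<in> borel_measurable M) \<and>
     (AE \<omega> in M. W 0 \<omega> = 0) \<and>
     (AE \<omega> in M. continuous_on {0..} (\<lambda>t. W t \<omega>)) \<and>
     (\<forall>s t. 0 \<le> s \<and> s < t \<longrightarrow>
        distributed M lborel (\<lambda>\<omega>. W t \<omega> - W s \<omega>)
          (\<lambda>z. ennreal (\<Prod>i\<in>UNIV. normal_density 0 (sqrt (t - s)) (z $ i)))) \<and>
     (\<forall>s t. 0 \<le> s \<and> s < t \<longrightarrow>
        indep_rvs M
          (PiM {0..s} (\<lambda>_. borel)) (\<lambda>\<omega>. \<lambda>u\<in>{0..s}. W u \<omega>)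
          borel (\<lambda>\<omega>. W t \<omega> - W s \<omega>))"

definition drifted_path ::
  "real ^ 'd \<Rightarrow> real \<Rightarrow> real ^ 'd \<Rightarrow> (real \<Rightarrow> real ^ 'd) \<Rightarrow> real \<Rightarrow> real ^ 'd" where
  "drifted_path b \<sigma> y w t = y + t *\<^sub>R b + \<sigma> *\<^sub>R w t"

definition exit_time :: "(real \<Rightarrow> 'a) \<Rightarrow> 'a set \<Rightarrow> ereal" where
  "exit_time X U = (INF t\<in>{t. 0 < t \<and> X t \<notin> U}. ereal t)"

text \<open>A path that never leaves \<open>U\<close> has exit time \<open>\<infinity>\<close>; its exit position is then \<open>X 0\<close> because
  \<open>real_of_ereal \<infinity> = 0\<close>. For the process below and bounded \<open>U\<close> this is a null event.\<close>

definition exit_position :: "(real \<Rightarrow> 'a) \<Rightarrow> 'a set \<Rightarrow> 'a" where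
  "exit_position X U = X (real_of_ereal (exit_time X U))"

text \<open>\<open>Y 1, Y 2, \<dots>\<close> is the sequence of exit positions started at \<open>x\<close>; the value \<open>Y 0\<close> is not used.
  In step \<open>n\<close> the process is started afresh at \<open>Y n\<close>, driven by a Brownian motion \<open>W n\<close> that is
  independent of the past \<open>Y 1, \<dots>, Y n\<close>. No joint structure of the family \<open>W\<close> is prescribed beyond
  this: it may consist of independent Brownian motions or of the successive restarts
  \<open>W n t = B (T n + t) - B (T n)\<close> of one Brownian motion \<open>B\<close> at the exit times. A ball of
  radius 0 is empty, so the sequence stays put once it has reached the boundary.\<close>

definition exit_sequence ::
  "'w measure \<Rightarrow> real ^ 'd \<Rightarrow> real \<Rightarrow> real \<Rightarrow> (real ^ 'd) set \<Rightarrow> real ^ 'd \<Rightarrow>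
   (nat \<Rightarrow> real \<Rightarrow> 'w \<Rightarrow> real ^ 'd) \<Rightarrow> (nat \<Rightarrow> 'w \<Rightarrow> real ^ 'd) \<Rightarrow> bool" where
  "exit_sequence M b \<sigma> \<theta> D x W Y \<longleftrightarrow>
     (\<forall>n\<ge>1. Y n \<in> borel_measurable M) \<and>
     (AE \<omega> in M. Y 1 \<omega> = x) \<and>
     (\<forall>n\<ge>1.
        standard_brownian_motion M (W n) \<and>
        indep_rvs M
          (PiM {1..n} (\<lambda>_. borel)) (\<lambda>\<omega>. \<lambda>k\<in>{1..n}. Y k \<omega>)
          (PiM {0..} (\<lambda>_. borel)) (\<lambda>\<omega>. \<lambda>t\<in>{0..}. W n t \<omega>) \<and>
        (AE \<omega> in M. Y (Suc n) \<omega> =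
           exit_position (drifted_path b \<sigma> (Y n \<omega>) (\<lambda>t. W n t \<omega>))
             (ball (Y n \<omega>) (\<theta> * infdist (Y n \<omega>) (frontier D)))))"

end

theory Submission
  imports Defs
begin

text \<open>
  Put \<open>S\<^sub>n = exp (c * Y\<^sub>n $ \<iota>)\<close> for a coordinate \<open>\<iota>\<close> and a constant \<open>c > 0\<close> so large that
  \<open>c b\<^sub>\<iota> + c\<^sup>2 \<sigma>\<^sup>2 / 2 \<ge> 0\<close>. Then \<open>S\<close> is a bounded submartingale, hence converges almost surely; this gives
  the convergence of every coordinate of \<open>Y\<^sub>n\<close>. As the step length \<open>\<theta> d(Y\<^sub>n, \<partial>D)\<close> tends to 0, the limit
  lies on \<open>\<partial>D\<close>.

  The submartingale inequality for one step avoids martingales in continuous time: the path is stopped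
  at the first point of a finite time grid at which it has left a slightly smaller ball, where
  independence of increments suffices. The second moments of the exponentials are bounded
  up to a fixed time horizon, so that the inequality survives refining the grid; afterwards the horizon
  tends to infinity and the smaller radius to the full one.
\<close>

subsection \<open>Independence and product measures\<close>

text \<open>The exponential is chosen for its multiplicative structure. Each grid step multiplies a
  path that is still running by a factor independent of its past with mean
  \<open>exp (\<kappa> * h)\<close>, where \<open>\<kappa> = c * b $ \<iota> + c\<^sup>2 *
  \<sigma>\<^sup>2 / 2\<close>. Hence only the sign of \<kappa> matters and no expected exit time
  has to be computed; a drift of either sign is absorbed by enlarging \<open>c\<close>. Conditional
  expectations are replaced by testing against nonnegative functions of the past, the form in which
  the independence of \<open>W n\<close> from \<open>Y 1\<close>, ..., \<open>Y n\<close> can be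
  used directly.

  The ball is shrunk because a grid detects only an open condition. A continuous path may touch the
  sphere of radius \<open>r\<close> and exceed \<open>r\<close> much later, whereas every radius
  below \<open>r\<close> is exceeded no later than the first contact. The horizon is finite because
  the walk on a grid may overshoot the ball, so that only its moments, whose bounds grow with time,
  are under control. Once the mesh has vanished the overshoot is gone and the ball itself bounds the
  integrand.\<close>

lemma indep_rvs_distr_Pair:
  assumes "prob_space M" and ind: "indep_rvs M N X N' Y"
  shows "distr M (N \<Otimes>\<^sub>M N') (\<lambda>\<omega>. (X \<omega>, Y \<omega>)) = distr M N X \<Otimes>\<^sub>M distr M N' Y"
proof -
  interpret prob_space M by fact
  have [measurable]: "X \<in> measurable M N" "Y \<in> measurable M N'"
    using ind by (auto simp: indep_rvs_def)
  interpret X: prob_space "distr M N X" by (rule prob_space_distr) simp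
  interpret Y: prob_space "distr M N' Y" by (rule prob_space_distr) simp
  have "distr M N X \<Otimes>\<^sub>M distr M N' Y = distr M (N \<Otimes>\<^sub>M N') (\<lambda>\<omega>. (X \<omega>, Y \<omega>))"
  proof (rule pair_measure_eqI)
    fix A B assume "A \<in> sets (distr M N X)" "B \<in> sets (distr M N' Y)"
    then have [measurable]: "A \<in> sets N" "B \<in> sets N'" by auto
    have "prob ((X -` A \<inter> space M) \<inter> (Y -` B \<inter> space M)) =
        prob (X -` A \<inter> space M) * prob (Y -` B \<inter> space M)"
      using ind unfolding indep_rvs_def by (intro indep_setD) auto
    moreover have "(X -` A \<inter> space M) \<inter> (Y -` B \<inter> space M) =
        (\<lambda>\<omega>. (X \<omega>, Y \<omega>)) -` (A \<times> B) \<inter> space M" by auto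
    ultimately show "emeasure (distr M N X) A * emeasure (distr M N' Y) B =
        emeasure (distr M (N \<Otimes>\<^sub>M N') (\<lambda>\<omega>. (X \<omega>, Y \<omega>))) (A \<times> B)"
      by (simp add: emeasure_distr emeasure_eq_measure ennreal_mult)
  qed (rule X.sigma_finite_measure_axioms, rule Y.sigma_finite_measure_axioms, simp cong: sets_pair_measure_cong)
  then show ?thesis by simp
qed

text \<open>Fubini for the product law: the inner integral freezes \<open>X\<close> at its value and
  averages over \<open>Y\<close> alone. This is how a random radius becomes a fixed one
  later.\<close>

lemma indep_rvs_nn_integral:
  assumes "prob_space M" and ind: "indep_rvs M N X N' Y"
    and [measurable]: "F \<in> borel_measurable (N \<Otimes>\<^sub>M N')"
  shows "(\<integral>\<^sup>+\<omega>. F (X \<omega>, Y \<omega>) \<partial>M) = (\<integral>\<^sup>+\<omega>. \<integral>\<^sup>+\<omega>'. F (X \<omega>, Y \<omega>') \<partial>M \<partial>M)"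
proof -
  interpret prob_space M by fact
  have [measurable]: "X \<in> measurable M N" "Y \<in> measurable M N'"
    using ind by (auto simp: indep_rvs_def)
  interpret Y: prob_space "distr M N' Y" by (rule prob_space_distr) simp
  have "(\<integral>\<^sup>+\<omega>. F (X \<omega>, Y \<omega>) \<partial>M) = integral\<^sup>N (distr M N X \<Otimes>\<^sub>M distr M N' Y) F"
    by (simp add: indep_rvs_distr_Pair[OF assms(1,2), symmetric] nn_integral_distr)
  also have "\<dots> = (\<integral>\<^sup>+x. \<integral>\<^sup>+y. F (x, y) \<partial>distr M N' Y \<partial>distr M N X)"
    by (simp add: Y.nn_integral_fst)
  also have "\<dots> = (\<integral>\<^sup>+\<omega>. \<integral>\<^sup>+y. F (X \<omega>, y) \<partial>distr M N' Y \<partial>M)"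
    by (subst nn_integral_distr) simp_all
  also have "\<dots> = (\<integral>\<^sup>+\<omega>. \<integral>\<^sup>+\<omega>'. F (X \<omega>, Y \<omega>') \<partial>M \<partial>M)"
    by (intro nn_integral_cong, subst nn_integral_distr)
      (auto intro!: measurable_Pair1' simp: measurable_space[of X M N])
  finally show ?thesis .
qed

lemma indep_rvs_nn_integral_mult:
  assumes "prob_space M" and ind: "indep_rvs M N X N' Y"
    and [measurable]: "f \<in> borel_measurable N" "g \<in> borel_measurable N'"
  shows "(\<integral>\<^sup>+\<omega>. f (X \<omega>) * g (Y \<omega>) \<partial>M) = (\<integral>\<^sup>+\<omega>. f (X \<omega>) \<partial>M) * (\<integral>\<^sup>+\<omega>. g (Y \<omega>) \<partial>M)"
proof -
  have [measurable]: "X \<in> measurable M N" "Y \<in> measurable M N'"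
    using ind by (auto simp: indep_rvs_def)
  show ?thesis
    using indep_rvs_nn_integral[OF assms(1,2), of "\<lambda>(x, y). f x * g y"]
    by (simp add: nn_integral_cmult nn_integral_multc)
qed

subsection \<open>Convergence of bounded submartingales\<close>

text \<open>Hypothesis \<open>sub\<close> is the submartingale property with bounded nonnegative
  functions of the past in place of conditional expectations. Since \<open>S\<close> is nonnegative,
  its second moments increase; being bounded they converge to some l, and a deviation of size
  \<epsilon> after time \<open>n\<close> has probability at most
  \<open>(l - m2 n) / \<epsilon>\<^sup>2\<close>, which tends to 0. A path that for each \<epsilon>
  eventually stops deviating is Cauchy.\<close>

lemma (in prob_space) bounded_submartingale_AE_convergent:
  fixes S :: "nat \<Rightarrow> 'a \<Rightarrow> real"
  assumes S[measurable]: "\<And>n. S n \<in> borel_measurable M"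
    and bd: "\<And>n \<omega>. \<omega> \<in> space M \<Longrightarrow> 0 \<le> S n \<omega>" "\<And>n \<omega>. \<omega> \<in> space M \<Longrightarrow> S n \<omega> \<le> K"
    and sub: "\<And>n g C. g \<in> borel_measurable (PiM {..n} (\<lambda>_. borel)) \<Longrightarrow>
      (\<And>\<omega>. \<omega> \<in> space M \<Longrightarrow> 0 \<le> g (\<lambda>k\<in>{..n}. S k \<omega>) \<and> g (\<lambda>k\<in>{..n}. S k \<omega>) \<le> C) \<Longrightarrow>
      expectation (\<lambda>\<omega>. g (\<lambda>k\<in>{..n}. S k \<omega>) * S n \<omega>)
        \<le> expectation (\<lambda>\<omega>. g (\<lambda>k\<in>{..n}. S k \<omega>) * S (Suc n) \<omega>)"
  shows "AE \<omega> in M. convergent (\<lambda>n. S n \<omega>)"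
proof -
  have K: "\<bar>S n \<omega>\<bar> \<le> K" if "\<omega> \<in> space M" for n \<omega>
    using bd[OF that, of n] by simp
  obtain \<omega>0 where "\<omega>0 \<in> space M" using not_empty by auto
  then have K0: "0 \<le> K" using K[of \<omega>0 0] by linarith
  define B where "B \<epsilon> n i \<omega> \<longleftrightarrow> (\<forall>j\<in>{n..i}. \<bar>S j \<omega> - S n \<omega>\<bar> < \<epsilon>)" for \<epsilon> n i \<omega>
  define q where "q \<epsilon> n i \<omega> = (if B \<epsilon> n i \<omega> then 1 else 0 :: real)" for \<epsilon> n i \<omega>
  have Bm[measurable]: "Measurable.pred M (B \<epsilon> n i)" for \<epsilon> n i
    unfolding B_def by measurable
  have qm[measurable]: "q \<epsilon> n i \<in> borel_measurable M" for \<epsilon> n i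
    unfolding q_def by measurable
  have int_Sq: "integrable M (\<lambda>\<omega>. (S n \<omega>)\<^sup>2)" for n
    by (rule integrable_const_bound[of _ "K\<^sup>2"])
      (auto simp: abs_le_square_iff[symmetric] K0 intro!: AE_I2 power_mono K)
  \<comment> \<open>An \<open>L\<^sup>2\<close> form of the maximal inequality: the left-hand side is the mean of \<open>(S - S\<^sub>n)\<^sup>2\<close>, stopped when
    the deviation reaches \<open>\<epsilon>\<close>, with the overshoot cut off. The second moments increase and are
    bounded, so the right-hand side is small for large \<open>n\<close>, uniformly in \<open>i\<close>.\<close>
  have max_ineq: "expectation (\<lambda>\<omega>. \<epsilon>\<^sup>2 * (1 - q \<epsilon> n i \<omega>) + q \<epsilon> n i \<omega> * (S i \<omega> - S n \<omega>)\<^sup>2)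
      \<le> expectation (\<lambda>\<omega>. (S i \<omega>)\<^sup>2) - expectation (\<lambda>\<omega>. (S n \<omega>)\<^sup>2)"
    if "n \<le> i" "\<epsilon> > 0" for n i \<epsilon>
    using that(1)
  proof (induction i rule: dec_induct)
    case base
    then show ?case using \<open>\<epsilon> > 0\<close> by (simp add: q_def B_def)
  next
    case (step i)
    let ?L = "\<lambda>i \<omega>. \<epsilon>\<^sup>2 * (1 - q \<epsilon> n i \<omega>) + q \<epsilon> n i \<omega> * (S i \<omega> - S n \<omega>)\<^sup>2"
    \<comment> \<open>Half the weight is w = \<open>v n\<close> before the deviation and w =
      \<open>v i\<close> after it. The induction step is then the identity (s' - w)^2 - (s - w)^2 =
      s'^2 - s^2 - 2 w (s' - s) for consecutive values s, s'; after the deviation its left side is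
      the nonnegative square of the step. Nonnegativity of \<open>S\<close> makes the weight
      admissible in \<open>sub\<close>.\<close>
    define G where "G v = (if \<forall>j\<in>{n..i}. \<bar>v j - v n\<bar> < \<epsilon> then 2 * v n else 2 * v i)" for v :: "nat \<Rightarrow> real"
    have Gm: "G \<in> borel_measurable (PiM {..i} (\<lambda>_. borel))"
    proof -
      have [measurable]: "(\<lambda>v. v j) \<in> borel_measurable (PiM {..i} (\<lambda>_. borel :: real measure))"
        if "j \<le> i" for j
        using that by (intro measurable_component_singleton) auto
      have "Measurable.pred (PiM {..i} (\<lambda>_. borel :: real measure)) (\<lambda>v. \<forall>j\<in>{n..i}. \<bar>v j - v n\<bar> < \<epsilon>)"
        using \<open>n \<le> i\<close> by (intro pred_intros_finite) (auto intro!: borel_measurable_less)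
      then show ?thesis unfolding G_def using \<open>n \<le> i\<close> by measurable
    qed
    define g where "g \<omega> = G (\<lambda>k\<in>{..i}. S k \<omega>)" for \<omega>
    have g_eq: "g \<omega> = 2 * (1 - q \<epsilon> n i \<omega>) * S i \<omega> + 2 * q \<epsilon> n i \<omega> * S n \<omega>" for \<omega>
      using \<open>n \<le> i\<close> by (auto simp: g_def G_def q_def B_def)
    have gm[measurable]: "g \<in> borel_measurable M"
      unfolding g_eq by measurable
    have g0: "0 \<le> g \<omega> \<and> g \<omega> \<le> 2 * K" if "\<omega> \<in> space M" for \<omega>
      using bd[OF that, of i] bd[OF that, of n] by (auto simp: g_eq q_def)
    have "expectation (\<lambda>\<omega>. g \<omega> * S i \<omega>) \<le> expectation (\<lambda>\<omega>. g \<omega> * S (Suc i) \<omega>)"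
      unfolding g_def by (rule sub[OF Gm, of "2 * K"]) (use g0 in \<open>auto simp: g_def\<close>)
    moreover have int_g: "integrable M (\<lambda>\<omega>. g \<omega> * S j \<omega>)" for j
      by (rule integrable_const_bound[of _ "2 * K * K"])
        (use g0 K K0 in \<open>auto simp: abs_mult intro!: AE_I2 mult_mono\<close>)
    moreover have int_L: "integrable M (?L j)" for j
    proof (rule integrable_const_bound[of _ "\<epsilon>\<^sup>2 + (2 * K)\<^sup>2"])
      have "(S j \<omega> - S n \<omega>)\<^sup>2 \<le> (2 * K)\<^sup>2" if "\<omega> \<in> space M" for \<omega>
        using K[OF that, of j] K[OF that, of n] by (intro abs_le_square_iff[THEN iffD1]) auto
      then show "AE \<omega> in M. norm (?L j \<omega>) \<le> \<epsilon>\<^sup>2 + (2 * K)\<^sup>2"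
        by (auto simp: q_def intro!: AE_I2 add_increasing2 add_increasing)
    qed measurable
    moreover have "expectation (?L (Suc i)) \<le>
      expectation (\<lambda>\<omega>. ?L i \<omega> + ((S (Suc i) \<omega>)\<^sup>2 - (S i \<omega>)\<^sup>2) - (g \<omega> * S (Suc i) \<omega> - g \<omega> * S i \<omega>))"
    proof (rule integral_mono)
      fix \<omega> assume "\<omega> \<in> space M"
      show "?L (Suc i) \<omega> \<le> ?L i \<omega> + ((S (Suc i) \<omega>)\<^sup>2 - (S i \<omega>)\<^sup>2) - (g \<omega> * S (Suc i) \<omega> - g \<omega> * S i \<omega>)"
      proof (cases "B \<epsilon> n i \<omega>")
        case True
        have "\<epsilon>\<^sup>2 \<le> (S (Suc i) \<omega> - S n \<omega>)\<^sup>2" if "\<not> B \<epsilon> n (Suc i) \<omega>"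
        proof -
          have "\<epsilon> \<le> \<bar>S (Suc i) \<omega> - S n \<omega>\<bar>"
            using that True \<open>n \<le> i\<close> by (auto simp: B_def atLeastAtMostSuc_conv)
          then show ?thesis using \<open>\<epsilon> > 0\<close> by (intro abs_le_square_iff[THEN iffD1]) auto
        qed
        with True show ?thesis
          by (auto simp: q_def g_eq power2_eq_square algebra_simps)
      next
        case False
        then have "\<not> B \<epsilon> n (Suc i) \<omega>" by (auto simp: B_def)
        moreover have "0 \<le> (S (Suc i) \<omega> - S i \<omega>)\<^sup>2" by simp
        ultimately show ?thesis using False
          by (auto simp: q_def g_eq power2_eq_square algebra_simps)
      qed
    qed (intro Bochner_Integration.integrable_add Bochner_Integration.integrable_diff int_L int_Sq int_g)+
    ultimately show ?case using step.IH int_Sq by simp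
  qed
  define m2 where "m2 n = expectation (\<lambda>\<omega>. (S n \<omega>)\<^sup>2)" for n
  have prob_B: "\<epsilon>\<^sup>2 * prob {\<omega> \<in> space M. \<not> B \<epsilon> n i \<omega>} \<le> m2 i - m2 n" if "n \<le> i" "\<epsilon> > 0" for n i \<epsilon>
  proof -
    have "\<epsilon>\<^sup>2 * prob {\<omega> \<in> space M. \<not> B \<epsilon> n i \<omega>}
        = expectation (\<lambda>\<omega>. \<epsilon>\<^sup>2 * indicator {\<omega> \<in> space M. \<not> B \<epsilon> n i \<omega>} \<omega>)"
      by simp
    also have "\<dots> \<le> expectation (\<lambda>\<omega>. \<epsilon>\<^sup>2 * (1 - q \<epsilon> n i \<omega>) + q \<epsilon> n i \<omega> * (S i \<omega> - S n \<omega>)\<^sup>2)"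
    proof (rule integral_mono)
      show "integrable M (\<lambda>\<omega>. \<epsilon>\<^sup>2 * (1 - q \<epsilon> n i \<omega>) + q \<epsilon> n i \<omega> * (S i \<omega> - S n \<omega>)\<^sup>2)"
      proof (rule integrable_const_bound[of _ "\<epsilon>\<^sup>2 + (2 * K)\<^sup>2"])
        have "(S i \<omega> - S n \<omega>)\<^sup>2 \<le> (2 * K)\<^sup>2" if "\<omega> \<in> space M" for \<omega>
          using K[OF that, of i] K[OF that, of n] by (intro abs_le_square_iff[THEN iffD1]) auto
        then show "AE \<omega> in M. norm (\<epsilon>\<^sup>2 * (1 - q \<epsilon> n i \<omega>) + q \<epsilon> n i \<omega> * (S i \<omega> - S n \<omega>)\<^sup>2) \<le> \<epsilon>\<^sup>2 + (2 * K)\<^sup>2"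
          by (auto simp: q_def intro!: AE_I2 add_increasing2 add_increasing)
      qed measurable
    qed (auto simp: q_def indicator_def intro!: integrable_const_bound[of _ 1])
    finally show ?thesis using max_ineq[OF that] by (simp add: m2_def)
  qed
  have "incseq m2"
  proof (rule incseq_SucI)
    fix n show "m2 n \<le> m2 (Suc n)"
      using prob_B[of n "Suc n" 1, simplified] measure_nonneg[of M "{\<omega> \<in> space M. \<not> B 1 n (Suc n) \<omega>}"]
      by linarith
  qed
  moreover have m2_le: "m2 n \<le> K\<^sup>2" for n
    unfolding m2_def using int_Sq
    by (intro integral_le_const) (auto simp: abs_le_square_iff[symmetric] K0 intro!: AE_I2 power_mono K bd)
  ultimately obtain l where l: "m2 \<longlonglongrightarrow> l" "\<And>n. m2 n \<le> l"
    using incseq_convergent[of m2 "K\<^sup>2"] by blast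
  have AE_dev: "AE \<omega> in M. \<exists>n. \<forall>i. B \<epsilon> n i \<omega>" if "\<epsilon> > 0" for \<epsilon>
  proof -
    define E where "E n = {\<omega> \<in> space M. \<exists>i. \<not> B \<epsilon> n i \<omega>}" for n
    have [measurable]: "E n \<in> events" for n unfolding E_def by measurable
    have E_le: "prob (E n) \<le> (l - m2 n) / \<epsilon>\<^sup>2" for n
    proof -
      have "(\<lambda>i. prob {\<omega> \<in> space M. \<not> B \<epsilon> n i \<omega>}) \<longlonglongrightarrow> prob (\<Union>i. {\<omega> \<in> space M. \<not> B \<epsilon> n i \<omega>})"
        by (rule finite_Lim_measure_incseq) (auto simp: incseq_def B_def)
      moreover have "(\<Union>i. {\<omega> \<in> space M. \<not> B \<epsilon> n i \<omega>}) = E n" by (auto simp: E_def)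
      moreover have "prob {\<omega> \<in> space M. \<not> B \<epsilon> n i \<omega>} \<le> (l - m2 n) / \<epsilon>\<^sup>2" if "i \<ge> n" for i
        using prob_B[OF that \<open>\<epsilon> > 0\<close>] l(2)[of i] \<open>\<epsilon> > 0\<close> by (simp add: field_simps)
      ultimately show ?thesis
        by (intro LIMSEQ_le_const2[where X = "\<lambda>i. prob {\<omega> \<in> space M. \<not> B \<epsilon> n i \<omega>}"]) auto
    qed
    have "(\<lambda>n. (l - m2 n) / \<epsilon>\<^sup>2) \<longlonglongrightarrow> (l - l) / \<epsilon>\<^sup>2"
      using l \<open>\<epsilon> > 0\<close> by (intro tendsto_intros) auto
    moreover have "prob (\<Inter>n. E n) \<le> (l - m2 n) / \<epsilon>\<^sup>2" for n
      by (rule order_trans[OF _ E_le[of n]], rule finite_measure_mono) auto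
    ultimately have "prob (\<Inter>n. E n) \<le> 0"
      by (intro LIMSEQ_le_const) auto
    then have "emeasure M (\<Inter>n. E n) = 0"
      by (simp add: emeasure_eq_measure measure_le_0_iff)
    then have "AE \<omega> in M. \<omega> \<notin> (\<Inter>n. E n)" by (intro AE_not_in null_setsI) auto
    then show ?thesis by (rule AE_mp) (auto simp: E_def)
  qed
  then have "AE \<omega> in M. \<forall>k. \<exists>n. \<forall>i. B (1 / real (Suc k)) n i \<omega>"
    by (subst AE_all_countable) auto
  then show ?thesis
  proof eventually_elim
    case (elim \<omega>)
    have "Cauchy (\<lambda>n. S n \<omega>)"
    proof (rule metric_CauchyI)
      fix e :: real assume "0 < e"
      then obtain k where k: "1 / real (Suc k) < e / 2"
        using reals_Archimedean[of "e / 2"] by (auto simp: inverse_eq_divide)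
      from elim obtain n where n: "\<And>i. B (1 / real (Suc k)) n i \<omega>" by auto
      have "dist (S i \<omega>) (S n \<omega>) < e / 2" if "i \<ge> n" for i
        using n[of i] that k by (force simp: B_def dist_real_def)
      then show "\<exists>N. \<forall>i\<ge>N. \<forall>j\<ge>N. dist (S i \<omega>) (S j \<omega>) < e"
        by (meson dist_triangle_half_l)
    qed
    then show ?case by (simp add: Cauchy_convergent_iff)
  qed
qed

subsection \<open>Increments of Brownian motion with drift\<close>

text \<open>Complete the square in the exponent: tilting a centred Gaussian shifts its mean, and the
  factor left over is its moment generating function.\<close>

lemma exp_times_normal_density:
  assumes "s > 0"
  shows "exp (\<beta> * z) * normal_density 0 s z
    = exp (\<beta>\<^sup>2 * s\<^sup>2 / 2) * normal_density (\<beta> * s\<^sup>2) s z"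
proof -
  have "\<beta> * z + - z\<^sup>2 / (2 * s\<^sup>2) = \<beta>\<^sup>2 * s\<^sup>2 / 2 + - (z - \<beta> * s\<^sup>2)\<^sup>2 / (2 * s\<^sup>2)"
    using assms by (simp add: field_simps power2_eq_square)
  then show ?thesis
    by (simp add: normal_density_def mult_exp_exp field_simps)
qed

lemma nn_integral_exp_normal_density:
  assumes "s > 0"
  shows "(\<integral>\<^sup>+z. ennreal (normal_density 0 s z) * ennreal (exp (\<beta> * z)) \<partial>lborel)
    = ennreal (exp (\<beta>\<^sup>2 * s\<^sup>2 / 2))"
proof -
  have "(\<integral>\<^sup>+z. ennreal (normal_density 0 s z) * ennreal (exp (\<beta> * z)) \<partial>lborel)
      = (\<integral>\<^sup>+z. ennreal (exp (\<beta>\<^sup>2 * s\<^sup>2 / 2)) * ennreal (normal_density (\<beta> * s\<^sup>2) s z) \<partial>lborel)"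
    using exp_times_normal_density[OF assms, of \<beta>]
    by (intro nn_integral_cong) (simp add: ennreal_mult[symmetric] mult.commute)
  also have "\<dots> = ennreal (exp (\<beta>\<^sup>2 * s\<^sup>2 / 2)) * ennreal (\<integral>z. normal_density (\<beta> * s\<^sup>2) s z \<partial>lborel)"
    using assms by (simp add: nn_integral_cmult nn_integral_eq_integral)
  finally show ?thesis using assms by simp
qed

text \<open>\<open>lborel\<close> on vectors is a product over \<open>Basis\<close>, and the axis
  vectors enumerate \<open>Basis\<close> by coordinates; every factor except that of \<iota>
  integrates to 1.\<close>

lemma nn_integral_vec_component:
  fixes f :: "real \<Rightarrow> real" and h :: "real \<Rightarrow> ennreal" and \<iota> :: "'d::finite"
  assumes [measurable]: "f \<in> borel_measurable borel" "h \<in> borel_measurable borel"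
    and "\<And>z. 0 \<le> f z" and f: "(\<integral>\<^sup>+z. f z \<partial>lborel) = 1"
  shows "(\<integral>\<^sup>+z. ennreal (\<Prod>i\<in>UNIV. f (z $ i)) * h (z $ \<iota>) \<partial>(lborel :: (real ^ 'd) measure))
    = (\<integral>\<^sup>+z. ennreal (f z) * h z \<partial>lborel)"
proof -
  define F where "F b z = ennreal (f z) * (if b = axis \<iota> 1 then h z else 1)" for b :: "real ^ 'd" and z
  have Basis: "(\<Prod>b\<in>Basis. G b) = (\<Prod>i\<in>UNIV. G (axis i 1))" for G :: "real ^ 'd \<Rightarrow> ennreal"
  proof -
    have "(Basis :: (real ^ 'd) set) = range (\<lambda>i. axis i 1)" by (auto simp: Basis_vec_def)
    moreover have "inj (\<lambda>i. axis i 1 :: real ^ 'd)" by (auto simp: inj_on_def axis_eq_axis)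
    ultimately show ?thesis by (metis prod.reindex_cong[OF _ _ refl])
  qed
  have "(\<integral>\<^sup>+z. ennreal (\<Prod>i\<in>UNIV. f (z $ i)) * h (z $ \<iota>) \<partial>(lborel :: (real ^ 'd) measure))
      = (\<integral>\<^sup>+z. (\<Prod>b\<in>Basis. F b (z \<bullet> b)) \<partial>(lborel :: (real ^ 'd) measure))"
    by (intro nn_integral_cong)
      (simp add: Basis F_def prod.distrib axis_eq_axis inner_axis prod_ennreal[symmetric] assms)
  also have "\<dots> = (\<Prod>b\<in>Basis. \<integral>\<^sup>+z. F b z \<partial>lborel)"
    by (rule nn_integral_lborel_prod) (auto simp: F_def)
  also have "\<dots> = (\<Prod>i\<in>UNIV. if i = \<iota> then \<integral>\<^sup>+z. ennreal (f z) * h z \<partial>lborel else 1)"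
    unfolding Basis by (intro prod.cong) (auto simp: F_def[abs_def] axis_eq_axis f)
  finally show ?thesis by simp
qed

lemma brownian_increment_component:
  fixes W :: "real \<Rightarrow> 'w \<Rightarrow> real ^ 'd"
  assumes W: "standard_brownian_motion M W" and st: "0 \<le> s" "s < t"
    and [measurable]: "h \<in> borel_measurable borel"
  shows "(\<integral>\<^sup>+\<omega>. h ((W t \<omega> - W s \<omega>) $ \<iota>) \<partial>M)
    = (\<integral>\<^sup>+z. ennreal (normal_density 0 (sqrt (t - s)) z) * h z \<partial>lborel)"
proof -
  have "distributed M lborel (\<lambda>\<omega>. W t \<omega> - W s \<omega>)
      (\<lambda>z. ennreal (\<Prod>i\<in>UNIV. normal_density 0 (sqrt (t - s)) (z $ i)))"
    using W st by (auto simp: standard_brownian_motion_def)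
  then have "(\<integral>\<^sup>+\<omega>. h ((W t \<omega> - W s \<omega>) $ \<iota>) \<partial>M) = (\<integral>\<^sup>+z.
      ennreal (\<Prod>i\<in>UNIV. normal_density 0 (sqrt (t - s)) (z $ i)) * h (z $ \<iota>) \<partial>lborel)"
    by (rule distributed_nn_integral[where g = "\<lambda>z. h (z $ \<iota>)", symmetric]) simp
  also have "\<dots> = (\<integral>\<^sup>+z. ennreal (normal_density 0 (sqrt (t - s)) z) * h z \<partial>lborel)"
    using st by (intro nn_integral_vec_component) (simp_all add: nn_integral_eq_integral)
  finally show ?thesis .
qed

text \<open>The rate in the exponent is the eigenvalue of the generator, drift derivative plus
  \<open>\<sigma>\<^sup>2 / 2\<close> times the Laplacian, on the function
  \<open>exp (c * z $ \<iota>)\<close>. Its nonnegativity is the condition placed on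
  \<open>c\<close> everywhere below.\<close>

lemma drifted_increment_exp_moment:
  fixes W :: "real \<Rightarrow> 'w \<Rightarrow> real ^ 'd"
  assumes W: "standard_brownian_motion M W" and st: "0 \<le> s" "s < t"
  shows "(\<integral>\<^sup>+\<omega>. ennreal (exp (c * (drifted_path b \<sigma> 0 (\<lambda>t. W t \<omega>) t
        - drifted_path b \<sigma> 0 (\<lambda>t. W t \<omega>) s) $ \<iota>)) \<partial>M)
    = ennreal (exp ((c * b $ \<iota> + c\<^sup>2 * \<sigma>\<^sup>2 / 2) * (t - s)))"
proof -
  have "(\<integral>\<^sup>+\<omega>. ennreal (exp (c * (drifted_path b \<sigma> 0 (\<lambda>t. W t \<omega>) t
        - drifted_path b \<sigma> 0 (\<lambda>t. W t \<omega>) s) $ \<iota>)) \<partial>M)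
    = (\<integral>\<^sup>+\<omega>. ennreal (exp (c * b $ \<iota> * (t - s)))
        * ennreal (exp (c * \<sigma> * (W t \<omega> - W s \<omega>) $ \<iota>)) \<partial>M)"
    by (intro nn_integral_cong)
      (simp add: drifted_path_def ennreal_mult[symmetric] mult_exp_exp algebra_simps)
  also have "\<dots> = (\<integral>\<^sup>+z. ennreal (normal_density 0 (sqrt (t - s)) z)
      * (ennreal (exp (c * b $ \<iota> * (t - s))) * ennreal (exp (c * \<sigma> * z))) \<partial>lborel)"
    by (rule brownian_increment_component[OF W st]) simp
  also have "\<dots> = (\<integral>\<^sup>+z. ennreal (exp (c * b $ \<iota> * (t - s)))
      * (ennreal (normal_density 0 (sqrt (t - s)) z) * ennreal (exp (c * \<sigma> * z))) \<partial>lborel)"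
    by (intro nn_integral_cong) (simp add: ac_simps)
  also have "\<dots> = ennreal (exp (c * b $ \<iota> * (t - s))) * ennreal (exp ((c * \<sigma>)\<^sup>2 * (sqrt (t - s))\<^sup>2 / 2))"
    using st by (subst nn_integral_cmult) (simp_all add: nn_integral_exp_normal_density)
  also have "\<dots> = ennreal (exp ((c * b $ \<iota> + c\<^sup>2 * \<sigma>\<^sup>2 / 2) * (t - s)))"
    using st by (simp add: ennreal_mult[symmetric] mult_exp_exp power_mult_distrib algebra_simps)
  finally show ?thesis .
qed

lemma normal_density_le:
  assumes "s > 0"
  shows "normal_density 0 s z \<le> 1 / s"
proof -
  have "1 / sqrt (2 * pi * s\<^sup>2) \<le> 1 / sqrt (s\<^sup>2)"
    using assms pi_gt3 by (intro divide_left_mono real_sqrt_le_mono) auto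
  moreover have "exp (- z\<^sup>2 / (2 * s\<^sup>2)) \<le> 1" by simp
  ultimately have "1 / sqrt (2 * pi * s\<^sup>2) * exp (- z\<^sup>2 / (2 * s\<^sup>2)) \<le> 1 / sqrt (s\<^sup>2) * 1"
    by (intro mult_mono) auto
  then show ?thesis using assms by (simp add: normal_density_def)
qed

text \<open>A coordinate of \<open>W t - W 0\<close> has density at most 1 / sqrt t, so it lies in
  an interval of length \<open>2 * k / \<sigma>\<close> with probability tending to 0 as t grows.
  The bound does not depend on where the interval lies, so the drift is harmless. One coordinate at
  positive integer times suffices. The lemma guarantees that balls are left in finite time.\<close>

lemma drifted_path_AE_unbounded:
  fixes W :: "real \<Rightarrow> 'w \<Rightarrow> real ^ 'd"
  assumes W: "standard_brownian_motion M W" and "\<sigma> > 0"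
  shows "AE \<omega> in M. \<forall>R. \<exists>t>0. R \<le> norm (drifted_path b \<sigma> 0 (\<lambda>t. W t \<omega>) t)"
proof -
  interpret prob_space M using W by (simp add: standard_brownian_motion_def)
  have [measurable]: "\<And>t. t \<ge> 0 \<Longrightarrow> W t \<in> borel_measurable M"
    and W0: "AE \<omega> in M. W 0 \<omega> = 0"
    using W by (auto simp: standard_brownian_motion_def)
  obtain \<iota> :: 'd where True by simp
  have AE_k: "AE \<omega> in M. \<exists>m::nat. real k \<le> \<bar>(real (Suc m) *\<^sub>R b + \<sigma> *\<^sub>R (W (real (Suc m)) \<omega> - W 0 \<omega>)) $ \<iota>\<bar>" for k :: nat
  proof -
    define E where "E m = {\<omega> \<in> space M. \<bar>(real (Suc m) *\<^sub>R b + \<sigma> *\<^sub>R (W (real (Suc m)) \<omega> - W 0 \<omega>)) $ \<iota>\<bar> < real k}" for m :: nat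
    have [measurable]: "E m \<in> events" for m unfolding E_def by measurable
    have E_le: "prob (E m) \<le> 2 * real k / \<sigma> * (1 / sqrt (real (Suc m)))" for m
    proof -
      define l where "l = real (Suc m) * b $ \<iota>"
      define A where "A = {(- real k - l) / \<sigma>..(real k - l) / \<sigma>}"
      have "emeasure M (E m) = (\<integral>\<^sup>+\<omega>. indicator (E m) \<omega> \<partial>M)" by simp
      also have "\<dots> \<le> (\<integral>\<^sup>+\<omega>. indicator A ((W (real (Suc m)) \<omega> - W 0 \<omega>) $ \<iota>) \<partial>M)"
        using \<open>\<sigma> > 0\<close>
        by (intro nn_integral_mono) (auto simp: indicator_def E_def A_def l_def field_simps abs_less_iff)
      also have "\<dots> = (\<integral>\<^sup>+z. ennreal (normal_density 0 (sqrt (real (Suc m))) z) * indicator A z \<partial>lborel)"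
        using brownian_increment_component[OF W, of 0 "real (Suc m)" "indicator A" \<iota>] by (simp add: A_def)
      also have "\<dots> \<le> (\<integral>\<^sup>+z. ennreal (1 / sqrt (real (Suc m))) * indicator A z \<partial>lborel)"
        by (intro nn_integral_mono mult_right_mono ennreal_leI normal_density_le) auto
      also have "\<dots> = ennreal (1 / sqrt (real (Suc m))) * ennreal (2 * real k / \<sigma>)"
      proof -
        have "(- real k - l) / \<sigma> \<le> (real k - l) / \<sigma>"
          using \<open>\<sigma> > 0\<close> by (intro divide_right_mono) auto
        moreover have "(real k - l) / \<sigma> - (- real k - l) / \<sigma> = 2 * real k / \<sigma>"
          by (simp add: diff_divide_distrib[symmetric])
        ultimately show ?thesis by (simp add: A_def nn_integral_cmult_indicator)
      qed
      finally show ?thesis using \<open>\<sigma> > 0\<close>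
        by (simp add: emeasure_eq_measure ennreal_mult[symmetric] mult.commute)
    qed
    have "(\<lambda>m. 2 * real k / \<sigma> * (1 / sqrt (real (Suc m)))) \<longlonglongrightarrow> 2 * real k / \<sigma> * 0"
      by (intro tendsto_mult_left) real_asymp
    moreover have "prob (\<Inter>m. E m) \<le> 2 * real k / \<sigma> * (1 / sqrt (real (Suc m)))" for m
      by (rule order_trans[OF _ E_le[of m]], rule finite_measure_mono) auto
    ultimately have "prob (\<Inter>m. E m) \<le> 2 * real k / \<sigma> * 0"
      by (intro LIMSEQ_le_const) auto
    then have "emeasure M (\<Inter>m. E m) = 0"
      by (simp add: emeasure_eq_measure measure_le_0_iff)
    then have "AE \<omega> in M. \<omega> \<notin> (\<Inter>m. E m)" by (intro AE_not_in null_setsI) auto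
    then show ?thesis by (rule AE_mp) (auto simp: E_def not_less)
  qed
  then have "AE \<omega> in M. \<forall>k. \<exists>m::nat. real k \<le> \<bar>(real (Suc m) *\<^sub>R b + \<sigma> *\<^sub>R (W (real (Suc m)) \<omega> - W 0 \<omega>)) $ \<iota>\<bar>"
    by (subst AE_all_countable) auto
  with W0 show ?thesis
  proof eventually_elim
    case (elim \<omega>)
    show ?case
    proof
      fix R :: real
      obtain k where "R \<le> real k" using real_arch_simple by blast
      moreover obtain m where "real k \<le> \<bar>(real (Suc m) *\<^sub>R b + \<sigma> *\<^sub>R W (real (Suc m)) \<omega>) $ \<iota>\<bar>"
        using elim by auto
      moreover note component_le_norm_cart[of "real (Suc m) *\<^sub>R b + \<sigma> *\<^sub>R W (real (Suc m)) \<omega>" \<iota>]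
      ultimately show "\<exists>t>0. R \<le> norm (drifted_path b \<sigma> 0 (\<lambda>t. W t \<omega>) t)"
        by (intro exI[of _ "real (Suc m)"]) (simp add: drifted_path_def)
    qed
  qed
qed

subsection \<open>Exit positions as limits along time grids\<close>

text \<open>The walk still takes the step that carries it out of the closed ball and is frozen from
  then on, so its value may overshoot \<rho>. Whether step \<open>Suc n\<close> is taken depends
  only on the indices up to \<open>n\<close>, which makes that decision independent of the next
  increment.\<close>

primrec stopped_walk :: "real \<Rightarrow> (nat \<Rightarrow> 'a::real_normed_vector) \<Rightarrow> nat \<Rightarrow> 'a" where
  "stopped_walk \<rho> v 0 = v 0"
| "stopped_walk \<rho> v (Suc n) = (if \<forall>j\<le>n. norm (v j) \<le> \<rho> then v (Suc n) else stopped_walk \<rho> v n)"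

lemma stopped_walk_alive:
  assumes "\<And>j. j < n \<Longrightarrow> norm (v j) \<le> \<rho>"
  shows "stopped_walk \<rho> v n = v n"
  using assms by (cases n) auto

text \<open>The case \<open>j = n\<close> claims nothing about \<open>norm (v j)\<close>: it covers
  a walk that is still inside when the grid ends.\<close>

lemma stopped_walk_first_escape:
  "\<exists>j\<le>n. stopped_walk \<rho> v n = v j \<and> (\<forall>i<j. norm (v i) \<le> \<rho>) \<and> (j < n \<longrightarrow> \<rho> < norm (v j))"
proof (induction n)
  case (Suc n)
  show ?case
  proof (cases "\<forall>j\<le>n. norm (v j) \<le> \<rho>")
    case True
    then show ?thesis by (intro exI[of _ "Suc n"]) auto
  next
    case False
    from Suc obtain j where j: "j \<le> n" "stopped_walk \<rho> v n = v j"
      "\<forall>i<j. norm (v i) \<le> \<rho>" "j < n \<longrightarrow> \<rho> < norm (v j)" by blast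
    have "\<rho> < norm (v j)"
    proof (cases "j < n")
      case False
      with \<open>\<not> (\<forall>j\<le>n. norm (v j) \<le> \<rho>)\<close> j show ?thesis
        by (metis le_neq_implies_less not_le_imp_less)
    qed (use j in auto)
    with j False show ?thesis by (intro exI[of _ j]) auto
  qed
qed simp

lemma stopped_walk_measurable:
  fixes v :: "'x \<Rightarrow> nat \<Rightarrow> real ^ 'd"
  assumes "\<And>j. (\<lambda>x. v x j) \<in> borel_measurable M" and [measurable]: "\<rho> \<in> borel_measurable M"
  shows "(\<lambda>x. stopped_walk (\<rho> x) (v x) n) \<in> borel_measurable M"
proof (induction n)
  case (Suc n)
  note [measurable] = assms(1) Suc
  show ?case by simp
qed (simp add: assms)

text \<open>Inserting \<open>T\<close> caps the time at the horizon and keeps \<open>Inf\<close>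
  away from the empty set. The inequality is strict so that a continuous path found outside stays
  outside for a while and is noticed by a fine grid.\<close>

definition escape_time :: "real \<Rightarrow> real \<Rightarrow> (real \<Rightarrow> 'a::real_normed_vector) \<Rightarrow> real" where
  "escape_time \<rho> T z = Inf (insert T {t \<in> {0..T}. \<rho> < norm (z t)})"

lemma escape_time_le: "t \<in> {0..T} \<Longrightarrow> \<rho> < norm (z t) \<or> t = T \<Longrightarrow> escape_time \<rho> T z \<le> t"
  unfolding escape_time_def by (intro cInf_lower bdd_belowI[of _ 0]) auto

lemma escape_time_ge:
  "(\<And>t. t \<in> {0..T} \<Longrightarrow> \<rho> < norm (z t) \<Longrightarrow> l \<le> t) \<Longrightarrow> l \<le> T \<Longrightarrow> l \<le> escape_time \<rho> T z"
  unfolding escape_time_def by (intro cInf_greatest) auto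

lemma escape_time_bounds:
  assumes "0 \<le> T"
  shows "0 \<le> escape_time \<rho> T z" "escape_time \<rho> T z \<le> T"
  using assms escape_time_ge[of T \<rho> z 0] escape_time_le[of T T \<rho> z] by auto

lemma norm_le_at_left_limit:
  fixes z :: "real \<Rightarrow> 'a::real_normed_vector"
  assumes z: "continuous_on {0..} z" and "0 \<le> t" and 0: "norm (z 0) \<le> \<rho>"
    and le: "\<And>s. 0 \<le> s \<Longrightarrow> s < t \<Longrightarrow> norm (z s) \<le> \<rho>"
  shows "norm (z t) \<le> \<rho>"
proof (cases "t = 0")
  case False
  with \<open>0 \<le> t\<close> have "0 < t" by simp
  define s where "s n = t * (1 - 1 / real (Suc n))" for n
  have s: "0 \<le> s n" "s n < t" for n
    using \<open>0 < t\<close> by (auto simp: s_def field_simps)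
  have "(\<lambda>n. 1 - 1 / real (Suc n)) \<longlonglongrightarrow> 1" by real_asymp
  then have "s \<longlonglongrightarrow> t * 1" unfolding s_def by (intro tendsto_mult_left)
  then have "(\<lambda>n. z (s n)) \<longlonglongrightarrow> z t"
    using z s \<open>0 \<le> t\<close> by (intro continuous_on_tendsto_compose[OF z]) auto
  then show ?thesis
    by (intro LIMSEQ_le_const2[OF tendsto_norm]) (use le s in auto)
qed (use 0 in simp)

text \<open>In contrast to the walk, a continuous path has no overshoot: strictly before the escape
  time it is inside, and the bound passes to the left limit.\<close>

lemma norm_escape_le:
  assumes "continuous_on {0..} z" "0 \<le> T" "norm (z 0) \<le> \<rho>"
  shows "norm (z (escape_time \<rho> T z)) \<le> \<rho>"
proof (rule norm_le_at_left_limit[OF assms(1)])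
  fix s assume s: "0 \<le> s" "s < escape_time \<rho> T z"
  then have "s \<le> T" using escape_time_bounds[OF assms(2), of \<rho> z] by simp
  with s escape_time_le[of s T \<rho> z] show "norm (z s) \<le> \<rho>" by force
qed (use assms escape_time_bounds in auto)

text \<open>The stopping times \<open>t k\<close> of the walks converge to the escape time. They are
  never earlier, since the path is outside at \<open>t k\<close> or \<open>t k = T\<close>. They are
  not much later, since some \<open>u\<close> just after the escape time is outside or equals
  \<open>T\<close>; in the former case continuity keeps the path outside near \<open>u\<close>,
  where a fine grid has a point. The grids need not be nested.\<close>

lemma stopped_walk_tendsto_escape:
  fixes z :: "real \<Rightarrow> 'a::real_normed_vector"
  assumes z: "continuous_on {0..} z" and "0 < T"
  shows "(\<lambda>k. stopped_walk \<rho> (\<lambda>j. z (T / real (Suc k) * real j)) (Suc k)) \<longlonglongrightarrow> z (escape_time \<rho> T z)"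
proof -
  let ?E = "escape_time \<rho> T z"
  have "\<exists>j. \<forall>k. j k \<le> Suc k \<and>
      stopped_walk \<rho> (\<lambda>j. z (T / real (Suc k) * real j)) (Suc k) = z (T / real (Suc k) * real (j k)) \<and>
      (\<forall>i<j k. norm (z (T / real (Suc k) * real i)) \<le> \<rho>) \<and>
      (j k < Suc k \<longrightarrow> \<rho> < norm (z (T / real (Suc k) * real (j k))))"
    by (intro choice allI) (use stopped_walk_first_escape in blast)
  then obtain j where j: "\<And>k. j k \<le> Suc k"
      "\<And>k. stopped_walk \<rho> (\<lambda>j. z (T / real (Suc k) * real j)) (Suc k) = z (T / real (Suc k) * real (j k))"
      "\<And>k i. i < j k \<Longrightarrow> norm (z (T / real (Suc k) * real i)) \<le> \<rho>"
      "\<And>k. j k < Suc k \<Longrightarrow> \<rho> < norm (z (T / real (Suc k) * real (j k)))"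
    by blast
  define t where "t k = T / real (Suc k) * real (j k)" for k
  have t_range: "t k \<in> {0..T}" for k
  proof -
    have "real (j k) / real (Suc k) \<le> 1"
      using of_nat_mono[OF j(1)[of k], where 'a = real] by (simp del: of_nat_Suc)
    then have "T * (real (j k) / real (Suc k)) \<le> T * 1"
      using \<open>0 < T\<close> by (intro mult_left_mono) auto
    then show ?thesis using \<open>0 < T\<close> by (simp add: t_def)
  qed
  have t_ge: "?E \<le> t k" for k
  proof (rule escape_time_le[OF t_range])
    have "t k = T" if "\<not> j k < Suc k"
    proof -
      have "j k = Suc k" using that j(1)[of k] by simp
      then show ?thesis by (simp add: t_def del: of_nat_Suc)
    qed
    then show "\<rho> < norm (z (t k)) \<or> t k = T"
      using j(4)[of k] by (auto simp: t_def)
  qed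
  have t_less: "\<forall>\<^sub>F k in sequentially. t k < ?E + e" if "e > 0" for e
  proof -
    obtain u where u: "u = T \<or> (u \<in> {0..T} \<and> \<rho> < norm (z u))" "u < ?E + e"
      using cInf_lessD[of "insert T {t \<in> {0..T}. \<rho> < norm (z t)}" "?E + e"] \<open>e > 0\<close>
      unfolding escape_time_def by auto
    show ?thesis
    proof (cases "u = T")
      case True
      have "t k < ?E + e" for k using t_range[of k] u(2) True by auto
      then show ?thesis by simp
    next
      case False
      then have u': "0 \<le> u" "u < T" "\<rho> < norm (z u)" using u by auto
      obtain d where d: "d > 0" "\<And>s. 0 \<le> s \<Longrightarrow> dist s u < d \<Longrightarrow> dist (z s) (z u) < norm (z u) - \<rho>"
        using z[unfolded continuous_on_iff, rule_format, of u "norm (z u) - \<rho>"] u' by auto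
      define d' where "d' = min d (min (T - u) (?E + e - u))"
      have "d' > 0" using d(1) u'(2) u(2) by (simp add: d'_def)
      have "(\<lambda>k. T / real (Suc k)) \<longlonglongrightarrow> 0" by real_asymp
      from order_tendstoD(2)[OF this \<open>d' > 0\<close>] show ?thesis
      proof eventually_elim
        case (elim k)
        define h where "h = T / real (Suc k)"
        have h: "0 < h" "h < d'" using \<open>0 < T\<close> elim by (auto simp: h_def)
        \<comment> \<open>\<open>h * real i\<close> is the first grid point at or after
          \<open>u\<close>, less than one mesh width away and hence still outside, so the walk stops
          there at the latest.\<close>
        define i where "i = nat \<lceil>u / h\<rceil>"
        have i: "u \<le> h * real i" "h * real i < u + h"
        proof -
          have "u / h \<le> real i" using u'(1) h by (simp add: i_def)
          then show "u \<le> h * real i" using h by (simp add: field_simps)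
          have "real i < u / h + 1"
            using u'(1) h by (simp add: i_def) linarith
          then show "h * real i < u + h" using h by (simp add: field_simps)
        qed
        have "dist (h * real i) u < d" using i h by (simp add: dist_real_def d'_def)
        then have "dist (z (h * real i)) (z u) < norm (z u) - \<rho>"
          using d(2)[of "h * real i"] h by simp
        moreover have "norm (z u) \<le> norm (z (h * real i)) + dist (z (h * real i)) (z u)"
          by (metis dist_norm norm_minus_commute norm_triangle_sub)
        ultimately have "\<rho> < norm (z (h * real i))" by linarith
        then have "j k \<le> i"
          using j(3)[of i k] unfolding h_def by fastforce
        then have "t k \<le> h * real i"
          unfolding t_def h_def[symmetric] using h by (intro mult_left_mono) auto
        also have "\<dots> < ?E + e" using i h by (simp add: d'_def)
        finally show ?case .
      qed
    qed
  qed
  have "t \<longlonglongrightarrow> ?E"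
  proof (rule order_tendstoI)
    fix a assume "a < ?E"
    then have "a < t k" for k using t_ge by (rule less_le_trans)
    then show "\<forall>\<^sub>F k in sequentially. a < t k" by simp
  next
    fix a assume "?E < a"
    then show "\<forall>\<^sub>F k in sequentially. t k < a" using t_less[of "a - ?E"] by simp
  qed
  then have "(\<lambda>k. z (t k)) \<longlonglongrightarrow> z ?E"
    using t_range escape_time_bounds[of T \<rho> z] \<open>0 < T\<close>
    by (intro continuous_on_tendsto_compose[OF z]) auto
  then show ?thesis unfolding j(2) t_def .
qed

text \<open>For \<open>r > 0\<close> the set of times with norm at least \<open>r\<close> is closed,
  because time 0 does not belong to it anyway; so the first contact \<open>\<tau>\<close> is
  attained, with norm exactly \<open>r\<close> by continuity from the left. A radius below
  \<open>r\<close> is exceeded by time \<open>\<tau>\<close> as soon as the horizon reaches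
  \<open>\<tau>\<close>. Conversely, on \<open>{0..l}\<close> with \<open>l < \<tau>\<close> the
  norm has a maximum below \<open>r\<close>, which the growing radii eventually pass, so the escape
  times are finally at least \<open>l\<close>.\<close>

lemma exit_position_path:
  fixes z :: "real \<Rightarrow> 'a::real_normed_vector"
  assumes z: "continuous_on {0..} z" and z0: "z 0 = 0" and "0 \<le> r"
    and ex: "\<exists>t>0. r \<le> norm (z t)"
  shows norm_exit_position: "norm (exit_position z (ball 0 r)) = r"
    and escape_tendsto_exit_position:
      "(\<lambda>m. z (escape_time (r * (1 - 1 / real (Suc m))) (real (Suc m)) z)) \<longlonglongrightarrow> exit_position z (ball 0 r)"
proof -
  define A where "A = {t. 0 < t \<and> r \<le> norm (z t)}"
  have A: "A \<noteq> {}" "bdd_below A" using ex by (auto simp: A_def intro: bdd_belowI[of _ 0])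
  define \<tau> where "\<tau> = Inf A"
  have "exit_time z (ball 0 r) = (INF t\<in>A. ereal t)"
    by (simp add: exit_time_def A_def not_less)
  also have "\<dots> = ereal \<tau>" unfolding \<tau>_def using A by (simp add: ereal_Inf')
  finally have exit: "exit_position z (ball 0 r) = z \<tau>" by (simp add: exit_position_def)
  have \<tau>0: "0 \<le> \<tau>" unfolding \<tau>_def using A by (intro cInf_greatest) (auto simp: A_def)
  let ?s = "\<lambda>m. r * (1 - 1 / real (Suc m))"
  let ?E = "\<lambda>m. escape_time (?s m) (real (Suc m)) z"
  have s: "0 \<le> ?s m" "?s m \<le> r" for m using \<open>0 \<le> r\<close> by (auto simp: field_simps)
  have "norm (z \<tau>) = r \<and> (\<lambda>m. z (?E m)) \<longlonglongrightarrow> z \<tau>"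
  proof (cases "r = 0")
    case True
    \<comment> \<open>The open ball of radius 0 is empty, so every positive time counts as an exit
      and the infimum is 0. The escape times themselves need not tend to 0 here, but the path
      vanishes at each of them.\<close>
    then have "\<tau> = 0" by (simp add: \<tau>_def A_def greaterThan_def[symmetric] cInf_greaterThan)
    moreover have "z (?E m) = 0" for m
      using norm_escape_le[OF z, of "real (Suc m)" "?s m"] True z0 by simp
    ultimately show ?thesis using True z0 by simp
  next
    case False
    with \<open>0 \<le> r\<close> have "0 < r" by simp
    have "A = {0..} \<inter> (\<lambda>t. norm (z t)) -` {r..}"
      using z0 \<open>0 < r\<close> by (auto simp: A_def less_le)
    moreover have "closed ({0..} \<inter> (\<lambda>t. norm (z t)) -` {r..})"
      by (intro continuous_closed_preimage continuous_intros z)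
    ultimately have "\<tau> \<in> A" unfolding \<tau>_def using A by (intro closed_contains_Inf) auto
    then have \<tau>: "0 < \<tau>" "r \<le> norm (z \<tau>)" by (auto simp: A_def)
    have before: "norm (z t) < r" if "0 \<le> t" "t < \<tau>" for t
    proof (rule ccontr)
      assume "\<not> norm (z t) < r"
      then have "t \<in> A" using that z0 \<open>0 < r\<close> by (cases "t = 0") (auto simp: A_def)
      then show False using that A(2) by (simp add: \<tau>_def cInf_lower leD)
    qed
    have "norm (z \<tau>) \<le> r"
      by (rule norm_le_at_left_limit[OF z \<tau>0]) (use before z0 \<open>0 < r\<close> in \<open>simp_all add: less_imp_le\<close>)
    with \<tau> have norm_eq: "norm (z \<tau>) = r" by simp
    have ev_le: "\<forall>\<^sub>F m in sequentially. \<tau> \<le> real (Suc m)"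
      by (rule eventually_sequentiallyI[of "nat \<lceil>\<tau>\<rceil>"]) linarith
    have E_le: "\<forall>\<^sub>F m in sequentially. ?E m \<le> \<tau>"
      using ev_le
    proof eventually_elim
      case (elim m)
      have "?s m < norm (z \<tau>)" using \<open>0 < r\<close> by (simp add: norm_eq field_simps)
      then show ?case using \<tau> elim by (intro escape_time_le) auto
    qed
    have E_ge: "\<forall>\<^sub>F m in sequentially. l \<le> ?E m" if "l < \<tau>" for l
    proof (cases "0 \<le> l")
      case True
      have "\<exists>x\<in>{0..l}. \<forall>y\<in>{0..l}. norm (z y) \<le> norm (z x)"
        using True by (intro continuous_attains_sup continuous_intros continuous_on_subset[OF z]) auto
      then obtain x where x: "x \<in> {0..l}" "\<And>y. y \<in> {0..l} \<Longrightarrow> norm (z y) \<le> norm (z x)" by blast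
      have "norm (z x) < r" using before x(1) that by simp
      have "?s \<longlonglongrightarrow> r" by real_asymp
      from order_tendstoD(1)[OF this \<open>norm (z x) < r\<close>] ev_le show ?thesis
      proof eventually_elim
        case (elim m)
        show ?case
        proof (rule escape_time_ge)
          fix t assume "t \<in> {0..real (Suc m)}" "?s m < norm (z t)"
          then show "l \<le> t" using x(2)[of t] elim by force
        qed (use elim that in auto)
      qed
    next
      case False
      then have "l \<le> ?E m" for m
        using escape_time_bounds(1)[of "real (Suc m)" "?s m" z] by linarith
      then show ?thesis by simp
    qed
    have "?E \<longlonglongrightarrow> \<tau>"
    proof (rule order_tendstoI)
      fix a assume "a < \<tau>"
      then obtain l where "a < l" "l < \<tau>" using dense by blast
      from E_ge[OF \<open>l < \<tau>\<close>] show "\<forall>\<^sub>F m in sequentially. a < ?E m"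
        by eventually_elim (use \<open>a < l\<close> in simp)
    next
      fix a assume "\<tau> < a"
      from E_le show "\<forall>\<^sub>F m in sequentially. ?E m < a"
        by eventually_elim (use \<open>\<tau> < a\<close> in simp)
    qed
    then have "(\<lambda>m. z (?E m)) \<longlonglongrightarrow> z \<tau>"
      using \<tau>0 by (intro continuous_on_tendsto_compose[OF z])
        (auto intro!: always_eventually escape_time_bounds(1))
    with norm_eq show ?thesis by simp
  qed
  then show "norm (exit_position z (ball 0 r)) = r"
    "(\<lambda>m. z (?E m)) \<longlonglongrightarrow> exit_position z (ball 0 r)" by (auto simp: exit)
qed

text \<open>Translation separates past and noise: the past then enters a step only through its
  starting point and radius, the noise only through a path from 0.\<close>

lemma exit_position_drifted_path:
  "exit_position (drifted_path b \<sigma> y w) (ball y r)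
    = y + exit_position (drifted_path b \<sigma> 0 w) (ball 0 r)"
proof -
  have "drifted_path b \<sigma> y w t = y + drifted_path b \<sigma> 0 w t" for t
    by (simp add: drifted_path_def)
  then show ?thesis by (simp add: exit_position_def exit_time_def dist_norm)
qed

subsection \<open>The submartingale inequality for one step\<close>

lemma drifted_path_measurable:
  fixes W :: "real \<Rightarrow> 'w \<Rightarrow> real ^ 'd"
  assumes "standard_brownian_motion M W" and "0 \<le> t"
  shows "(\<lambda>\<omega>. drifted_path b \<sigma> y (\<lambda>t. W t \<omega>) t) \<in> borel_measurable M"
proof -
  have [measurable]: "W t \<in> borel_measurable M"
    using assms by (auto simp: standard_brownian_motion_def)
  show ?thesis unfolding drifted_path_def by measurable
qed

lemma stopped_walk_exp_step:
  fixes W :: "real \<Rightarrow> 'w \<Rightarrow> real ^ 'd" and \<rho> :: real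
  assumes W: "standard_brownian_motion M W" and "0 < h"
    and \<kappa>_def: "\<kappa> = c * b $ \<iota> + c\<^sup>2 * \<sigma>\<^sup>2 / 2" and "0 \<le> \<kappa>"
  defines "v \<equiv> \<lambda>\<omega> j. drifted_path b \<sigma> 0 (\<lambda>t. W t \<omega>) (h * real j)"
  defines "m \<equiv> \<lambda>n. \<integral>\<^sup>+\<omega>. ennreal (exp (c * stopped_walk \<rho> (v \<omega>) n $ \<iota>)) \<partial>M"
  shows "m n \<le> m (Suc n)" "m (Suc n) \<le> ennreal (exp (\<kappa> * h)) * m n"
proof -
  interpret prob_space M using W by (simp add: standard_brownian_motion_def)
  have [measurable]: "(\<lambda>\<omega>. v \<omega> j) \<in> borel_measurable M" for j
    unfolding v_def by (rule drifted_path_measurable[OF W]) (use \<open>0 < h\<close> in simp)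
  have [measurable]: "(\<lambda>\<omega>. stopped_walk \<rho> (v \<omega>) n $ \<iota>) \<in> borel_measurable M"
    by (intro measurable_compose[OF stopped_walk_measurable borel_measurable_nth]) auto
  have [measurable]: "(\<lambda>\<omega>. v \<omega> j $ \<iota>) \<in> borel_measurable M" for j
    by (rule measurable_compose[OF _ borel_measurable_nth]) simp
  have hn: "0 \<le> h * real n" "h * real n < h * real (Suc n)" using \<open>0 < h\<close> by auto
  define alive where "alive \<omega> \<longleftrightarrow> (\<forall>j\<le>n. norm (v \<omega> j) \<le> \<rho>)" for \<omega>
  have [measurable]: "Measurable.pred M alive" unfolding alive_def by measurable
  define P where "P \<omega> = (if alive \<omega> then 0 else ennreal (exp (c * stopped_walk \<rho> (v \<omega>) n $ \<iota>)))" for \<omega>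
  define Q where "Q \<omega> = (if alive \<omega> then ennreal (exp (c * v \<omega> n $ \<iota>)) else 0)" for \<omega>
  define X where "X \<omega> = ennreal (exp (c * (v \<omega> (Suc n) $ \<iota> - v \<omega> n $ \<iota>)))" for \<omega>
  have [measurable]: "P \<in> borel_measurable M" unfolding P_def by measurable
  have [measurable]: "Q \<in> borel_measurable M" unfolding Q_def by measurable
  have [measurable]: "X \<in> borel_measurable M" unfolding X_def by measurable
  have m_n: "m n = (\<integral>\<^sup>+\<omega>. P \<omega> \<partial>M) + (\<integral>\<^sup>+\<omega>. Q \<omega> \<partial>M)"
    unfolding m_def
    by (subst nn_integral_add[symmetric])
      (auto intro!: nn_integral_cong simp: P_def Q_def alive_def stopped_walk_alive)
  have "m (Suc n) = (\<integral>\<^sup>+\<omega>. P \<omega> \<partial>M) + (\<integral>\<^sup>+\<omega>. Q \<omega> * X \<omega> \<partial>M)"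
    unfolding m_def
    by (subst nn_integral_add[symmetric])
      (auto intro!: nn_integral_cong
        simp: P_def Q_def X_def alive_def ennreal_mult[symmetric] mult_exp_exp algebra_simps)
  also have "(\<integral>\<^sup>+\<omega>. Q \<omega> * X \<omega> \<partial>M) = (\<integral>\<^sup>+\<omega>. Q \<omega> \<partial>M) * (\<integral>\<^sup>+\<omega>. X \<omega> \<partial>M)"
  proof -
    let ?N = "PiM {0..h * real n} (\<lambda>_. borel :: (real ^ 'd) measure)"
    have ind: "indep_rvs M ?N (\<lambda>\<omega>. \<lambda>u\<in>{0..h * real n}. W u \<omega>)
        borel (\<lambda>\<omega>. W (h * real (Suc n)) \<omega> - W (h * real n) \<omega>)"
      using W hn unfolding standard_brownian_motion_def by blast
    have [measurable]: "(\<lambda>p. p (h * real j)) \<in> borel_measurable ?N" if "j \<le> n" for j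
      using that \<open>0 < h\<close> by (intro measurable_component_singleton) auto
    have [measurable]: "(\<lambda>p. drifted_path b \<sigma> 0 p (h * real j)) \<in> borel_measurable ?N" if "j \<le> n" for j
      using that unfolding drifted_path_def by measurable
    have [measurable]: "(\<lambda>p. drifted_path b \<sigma> 0 p (h * real n) $ \<iota>) \<in> borel_measurable ?N"
      by (rule measurable_compose[OF _ borel_measurable_nth]) simp
    \<comment> \<open>\<open>Q\<close> as a function of the path up to time
      \<open>h * real n\<close>. Only finitely many of the uncountably many coordinates enter,
      whence measurability on the product space.\<close>
    let ?f = "\<lambda>p. if \<forall>j\<in>{..n}. norm (drifted_path b \<sigma> 0 p (h * real j)) \<le> \<rho>
        then ennreal (exp (c * drifted_path b \<sigma> 0 p (h * real n) $ \<iota>)) else 0"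
    let ?g = "\<lambda>z :: real ^ 'd. ennreal (exp (c * (h *\<^sub>R b + \<sigma> *\<^sub>R z) $ \<iota>))"
    have "Measurable.pred ?N (\<lambda>p. \<forall>j\<in>{..n}. norm (drifted_path b \<sigma> 0 p (h * real j)) \<le> \<rho>)"
      by (intro pred_intros_finite) auto
    then have "?f \<in> borel_measurable ?N" by measurable
    from indep_rvs_nn_integral_mult[OF prob_space_axioms ind this, of ?g]
    show ?thesis
      using \<open>0 < h\<close>
      by (simp add: Q_def X_def alive_def v_def drifted_path_def Ball_def algebra_simps cong: if_cong)
  qed
  also have "(\<integral>\<^sup>+\<omega>. X \<omega> \<partial>M) = ennreal (exp (\<kappa> * h))"
    using drifted_increment_exp_moment[OF W hn, of c b \<sigma> \<iota>]
    by (simp add: X_def v_def \<kappa>_def algebra_simps)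
  finally have m_Suc: "m (Suc n) = (\<integral>\<^sup>+\<omega>. P \<omega> \<partial>M) + (\<integral>\<^sup>+\<omega>. Q \<omega> \<partial>M) * ennreal (exp (\<kappa> * h))" .
  have e: "1 \<le> ennreal (exp (\<kappa> * h))" using \<open>0 \<le> \<kappa>\<close> \<open>0 < h\<close> by simp
  show "m n \<le> m (Suc n)"
    using mult_left_mono[OF e, of "\<integral>\<^sup>+\<omega>. Q \<omega> \<partial>M"] unfolding m_n m_Suc by (intro add_left_mono) simp
  show "m (Suc n) \<le> ennreal (exp (\<kappa> * h)) * m n"
    using mult_right_mono[OF e, of "\<integral>\<^sup>+\<omega>. P \<omega> \<partial>M"] unfolding m_n m_Suc distrib_left
    by (intro add_mono) (simp_all add: mult.commute)
qed

text \<open>The lower bound is the submartingale inequality on a grid. The upper bound sees the grid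
  only through the elapsed time \<open>h * real n\<close>; applied with \<open>2 * c\<close> it
  controls second moments uniformly in the mesh.\<close>

lemma stopped_walk_exp_bounds:
  fixes W :: "real \<Rightarrow> 'w \<Rightarrow> real ^ 'd" and \<rho> :: real
  assumes W: "standard_brownian_motion M W" and "0 < h"
    and \<kappa>_def: "\<kappa> = c * b $ \<iota> + c\<^sup>2 * \<sigma>\<^sup>2 / 2" and "0 \<le> \<kappa>"
  defines "v \<equiv> \<lambda>\<omega> j. drifted_path b \<sigma> 0 (\<lambda>t. W t \<omega>) (h * real j)"
  defines "m \<equiv> \<lambda>n. \<integral>\<^sup>+\<omega>. ennreal (exp (c * stopped_walk \<rho> (v \<omega>) n $ \<iota>)) \<partial>M"
  shows "1 \<le> m n \<and> m n \<le> ennreal (exp (\<kappa> * h * real n))"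
proof (induction n)
  case 0
  interpret prob_space M using W by (simp add: standard_brownian_motion_def)
  have "AE \<omega> in M. W 0 \<omega> = 0" using W by (simp add: standard_brownian_motion_def)
  then have "AE \<omega> in M. ennreal (exp (c * stopped_walk \<rho> (v \<omega>) 0 $ \<iota>)) = 1"
    by eventually_elim (simp add: v_def drifted_path_def)
  then have "m 0 = (\<integral>\<^sup>+\<omega>. 1 \<partial>M)"
    unfolding m_def by (rule nn_integral_cong_AE)
  then show ?case by (simp add: emeasure_space_1)
next
  case (Suc n)
  have step: "m n \<le> m (Suc n)" "m (Suc n) \<le> ennreal (exp (\<kappa> * h)) * m n"
    unfolding m_def v_def by (rule stopped_walk_exp_step[OF assms(1-4)])+
  have "m (Suc n) \<le> ennreal (exp (\<kappa> * h)) * ennreal (exp (\<kappa> * h * real n))"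
    using step(2) Suc by (meson mult_left_mono order_trans zero_le)
  also have "\<dots> = ennreal (exp (\<kappa> * h * real (Suc n)))"
    by (simp add: ennreal_mult[symmetric] mult_exp_exp algebra_simps)
  finally show ?case using step(1) Suc by auto
qed

text \<open>The truncation rests on \<open>x \<le> min L x + x\<^sup>2 / L\<close>; it makes the integrands bounded, so that
  the limit of vanishing mesh can be taken under the integral.\<close>

lemma stopped_walk_exp_truncated:
  fixes W :: "real \<Rightarrow> 'w \<Rightarrow> real ^ 'd"
  assumes W: "standard_brownian_motion M W" and "0 < h" and "0 < L"
    and "0 \<le> c * b $ \<iota> + c\<^sup>2 * \<sigma>\<^sup>2 / 2"
    and \<kappa>_def: "\<kappa> = 2 * c * b $ \<iota> + (2 * c)\<^sup>2 * \<sigma>\<^sup>2 / 2" and "0 \<le> \<kappa>"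
  defines "v \<equiv> \<lambda>\<omega> j. drifted_path b \<sigma> 0 (\<lambda>t. W t \<omega>) (h * real j)"
  shows "1 \<le> (\<integral>\<^sup>+\<omega>. ennreal (min L (exp (c * stopped_walk \<rho> (v \<omega>) n $ \<iota>))) \<partial>M)
    + ennreal (exp (\<kappa> * h * real n) / L)"
proof -
  have [measurable]: "(\<lambda>\<omega>. v \<omega> j) \<in> borel_measurable M" for j
    unfolding v_def by (rule drifted_path_measurable[OF W]) (use \<open>0 < h\<close> in simp)
  have [measurable]: "(\<lambda>\<omega>. stopped_walk \<rho> (v \<omega>) n $ \<iota>) \<in> borel_measurable M"
    by (intro measurable_compose[OF stopped_walk_measurable borel_measurable_nth]) auto
  let ?Z = "\<lambda>\<omega>. stopped_walk \<rho> (v \<omega>) n $ \<iota>"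
  have "1 \<le> (\<integral>\<^sup>+\<omega>. ennreal (exp (c * ?Z \<omega>)) \<partial>M)"
    using stopped_walk_exp_bounds[OF W \<open>0 < h\<close> refl assms(4)] unfolding v_def by blast
  also have "\<dots> \<le> (\<integral>\<^sup>+\<omega>. ennreal (min L (exp (c * ?Z \<omega>))) + ennreal (1 / L) * ennreal (exp (2 * c * ?Z \<omega>)) \<partial>M)"
  proof (rule nn_integral_mono)
    fix \<omega>
    define x where "x = exp (c * ?Z \<omega>)"
    have x2: "exp (2 * c * ?Z \<omega>) = x * x" by (simp add: x_def mult_exp_exp)
    have "0 < x" by (simp add: x_def)
    have "x \<le> min L x + 1 / L * (x * x)"
    proof (cases "x \<le> L")
      case False
      then have "x * L \<le> x * x" using \<open>0 < x\<close> by simp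
      then have "x \<le> 1 / L * (x * x)" using \<open>0 < L\<close> by (simp add: field_simps)
      then show ?thesis using \<open>0 < L\<close> \<open>0 < x\<close> by (simp add: min_def)
    qed (use \<open>0 < L\<close> in simp)
    then show "ennreal (exp (c * ?Z \<omega>)) \<le> ennreal (min L (exp (c * ?Z \<omega>))) + ennreal (1 / L) * ennreal (exp (2 * c * ?Z \<omega>))"
      using \<open>0 < L\<close> \<open>0 < x\<close> unfolding x2 x_def[symmetric]
      by (simp add: ennreal_mult[symmetric] ennreal_plus[symmetric] del: ennreal_plus)
  qed
  also have "\<dots> = (\<integral>\<^sup>+\<omega>. ennreal (min L (exp (c * ?Z \<omega>))) \<partial>M)
      + ennreal (1 / L) * (\<integral>\<^sup>+\<omega>. ennreal (exp (2 * c * ?Z \<omega>)) \<partial>M)"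
    by (simp add: nn_integral_add nn_integral_cmult)
  also have "\<dots> \<le> (\<integral>\<^sup>+\<omega>. ennreal (min L (exp (c * ?Z \<omega>))) \<partial>M)
      + ennreal (1 / L) * ennreal (exp (\<kappa> * h * real n))"
    using stopped_walk_exp_bounds[OF W \<open>0 < h\<close> \<kappa>_def \<open>0 \<le> \<kappa>\<close>, of \<rho> n]
    by (intro add_left_mono mult_left_mono) (auto simp: v_def)
  also have "ennreal (1 / L) * ennreal (exp (\<kappa> * h * real n)) = ennreal (exp (\<kappa> * h * real n) / L)"
    using \<open>0 < L\<close> by (simp add: ennreal_mult[symmetric])
  finally show ?thesis .
qed

text \<open>With the past frozen the radius is a constant and the inequality for fixed radius
  applies; integrating against \<open>g\<close> restores the past. Fubini is used at the level of
  the walk, a function of finitely many coordinates of the path, because the exit position depends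
  on uncountably many of them.\<close>

lemma stopped_walk_exp_truncated_random_radius:
  fixes W :: "real \<Rightarrow> 'w \<Rightarrow> real ^ 'd"
  assumes W: "standard_brownian_motion M W" and "0 < h" and "0 < L"
    and \<kappa>1: "0 \<le> c * b $ \<iota> + c\<^sup>2 * \<sigma>\<^sup>2 / 2"
    and \<kappa>_def: "\<kappa> = 2 * c * b $ \<iota> + (2 * c)\<^sup>2 * \<sigma>\<^sup>2 / 2" and \<kappa>2: "0 \<le> \<kappa>"
    and ind: "indep_rvs M N X (PiM {0..} (\<lambda>_. borel)) (\<lambda>\<omega>. \<lambda>t\<in>{0..}. W t \<omega>)"
    and g[measurable]: "g \<in> borel_measurable N" and \<rho>[measurable]: "\<rho> \<in> borel_measurable N"
  defines "v \<equiv> \<lambda>\<omega> j. drifted_path b \<sigma> 0 (\<lambda>t. W t \<omega>) (h * real j)"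
  shows "(\<integral>\<^sup>+\<omega>. g (X \<omega>) \<partial>M)
    \<le> (\<integral>\<^sup>+\<omega>. g (X \<omega>) * ennreal (min L (exp (c * stopped_walk (\<rho> (X \<omega>)) (v \<omega>) n $ \<iota>))) \<partial>M)
      + ennreal (exp (\<kappa> * h * real n) / L) * (\<integral>\<^sup>+\<omega>. g (X \<omega>) \<partial>M)"
proof -
  interpret prob_space M using W by (simp add: standard_brownian_motion_def)
  have [measurable]: "(\<lambda>\<omega>. v \<omega> j) \<in> borel_measurable M" for j
    unfolding v_def by (rule drifted_path_measurable[OF W]) (use \<open>0 < h\<close> in simp)
  have X[measurable]: "X \<in> measurable M N" using ind by (simp add: indep_rvs_def)
  have [measurable]: "(\<lambda>\<omega>. stopped_walk (\<rho> (X \<omega>)) (v \<omega>) n $ \<iota>) \<in> borel_measurable M"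
    by (intro measurable_compose[OF stopped_walk_measurable borel_measurable_nth]) auto
  have [measurable]: "(\<lambda>\<omega>. stopped_walk r (v \<omega>) n $ \<iota>) \<in> borel_measurable M" for r
    by (intro measurable_compose[OF stopped_walk_measurable borel_measurable_nth]) auto
  let ?T = "\<lambda>\<omega> r. ennreal (min L (exp (c * stopped_walk r (v \<omega>) n $ \<iota>)))"
  let ?e = "ennreal (exp (\<kappa> * h * real n) / L)"
  let ?P = "PiM {0..} (\<lambda>_. borel :: (real ^ 'd) measure)"
  define F where "F = (\<lambda>(x, p). g x * ennreal (min L
      (exp (c * stopped_walk (\<rho> x) (\<lambda>j. drifted_path b \<sigma> 0 p (h * real j)) n $ \<iota>))))"
  have [measurable]: "(\<lambda>p. p (h * real j)) \<in> borel_measurable ?P" for j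
    using \<open>0 < h\<close> by (intro measurable_component_singleton) auto
  have [measurable]: "(\<lambda>p. drifted_path b \<sigma> 0 p (h * real j)) \<in> borel_measurable ?P" for j
    unfolding drifted_path_def by measurable
  have [measurable]: "(\<lambda>q. stopped_walk (\<rho> (fst q)) (\<lambda>j. drifted_path b \<sigma> 0 (snd q) (h * real j)) n $ \<iota>)
      \<in> borel_measurable (N \<Otimes>\<^sub>M ?P)"
    by (rule measurable_compose[OF stopped_walk_measurable borel_measurable_nth]) measurable
  have F: "F \<in> borel_measurable (N \<Otimes>\<^sub>M ?P)" unfolding F_def by measurable
  have F_eq: "F (x, \<lambda>t\<in>{0..}. W t \<omega>) = g x * ?T \<omega> (\<rho> x)" for x \<omega>
    using \<open>0 < h\<close> by (simp add: F_def v_def drifted_path_def)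
  have "(\<lambda>q. stopped_walk (\<rho> (X (fst q))) (v (snd q)) n $ \<iota>) \<in> borel_measurable (M \<Otimes>\<^sub>M M)"
    by (rule measurable_compose[OF stopped_walk_measurable borel_measurable_nth]) measurable
  then have "(\<lambda>q. g (X (fst q)) * ?T (snd q) (\<rho> (X (fst q)))) \<in> borel_measurable (M \<Otimes>\<^sub>M M)"
    by measurable
  from borel_measurable_nn_integral_fst[OF this]
  have inner: "(\<lambda>\<omega>. \<integral>\<^sup>+\<omega>'. g (X \<omega>) * ?T \<omega>' (\<rho> (X \<omega>)) \<partial>M) \<in> borel_measurable M" by simp
  have "(\<integral>\<^sup>+\<omega>. g (X \<omega>) \<partial>M) \<le> (\<integral>\<^sup>+\<omega>. g (X \<omega>) * ((\<integral>\<^sup>+\<omega>'. ?T \<omega>' (\<rho> (X \<omega>)) \<partial>M) + ?e) \<partial>M)"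
  proof (rule nn_integral_mono)
    fix \<omega>
    have "1 \<le> (\<integral>\<^sup>+\<omega>'. ?T \<omega>' (\<rho> (X \<omega>)) \<partial>M) + ?e"
      unfolding v_def by (rule stopped_walk_exp_truncated[OF W \<open>0 < h\<close> \<open>0 < L\<close> \<kappa>1 \<kappa>_def \<kappa>2])
    from mult_left_mono[OF this, of "g (X \<omega>)"]
    show "g (X \<omega>) \<le> g (X \<omega>) * ((\<integral>\<^sup>+\<omega>'. ?T \<omega>' (\<rho> (X \<omega>)) \<partial>M) + ?e)" by simp
  qed
  also have "\<dots> = (\<integral>\<^sup>+\<omega>. (\<integral>\<^sup>+\<omega>'. g (X \<omega>) * ?T \<omega>' (\<rho> (X \<omega>)) \<partial>M) + ?e * g (X \<omega>) \<partial>M)"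
    by (simp add: nn_integral_cmult distrib_left mult.commute)
  also have "\<dots> = (\<integral>\<^sup>+\<omega>. \<integral>\<^sup>+\<omega>'. g (X \<omega>) * ?T \<omega>' (\<rho> (X \<omega>)) \<partial>M \<partial>M) + ?e * (\<integral>\<^sup>+\<omega>. g (X \<omega>) \<partial>M)"
    by (subst nn_integral_add[OF inner]) (simp_all add: nn_integral_cmult)
  also have "(\<integral>\<^sup>+\<omega>. \<integral>\<^sup>+\<omega>'. g (X \<omega>) * ?T \<omega>' (\<rho> (X \<omega>)) \<partial>M \<partial>M)
      = (\<integral>\<^sup>+\<omega>. g (X \<omega>) * ?T \<omega> (\<rho> (X \<omega>)) \<partial>M)"
    using indep_rvs_nn_integral[OF prob_space_axioms ind F] by (simp add: F_eq)
  finally show ?thesis .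
qed

text \<open>Reverse Fatou with dominating function \<open>w\<close>. The limit \<open>u'\<close> may
  fail to be measurable, as happens for evaluations of paths that are continuous only almost surely;
  its integral is still that of the measurable \<open>limsup\<close>, with which it agrees almost
  everywhere. Finiteness of \<open>J\<close> allows it to be moved across the inequality.\<close>

lemma le_nn_integral_limit_plus:
  fixes u :: "nat \<Rightarrow> 'a \<Rightarrow> ennreal"
  assumes "\<And>k. u k \<in> borel_measurable M" "w \<in> borel_measurable M"
    and "\<And>k. AE x in M. u k x \<le> w x" "(\<integral>\<^sup>+x. w x \<partial>M) < \<infinity>"
    and lim: "AE x in M. (\<lambda>k. u k x) \<longlonglongrightarrow> u' x"
    and J: "J < \<infinity>" and le: "\<And>k. I \<le> (\<integral>\<^sup>+x. u k x \<partial>M) + J"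
  shows "I \<le> (\<integral>\<^sup>+x. u' x \<partial>M) + J"
proof -
  have "(\<integral>\<^sup>+x. limsup (\<lambda>k. u k x) \<partial>M) = (\<integral>\<^sup>+x. u' x \<partial>M)"
    using lim by (intro nn_integral_cong_AE, eventually_elim) (auto intro: lim_imp_Limsup)
  moreover have "limsup (\<lambda>k. integral\<^sup>N M (u k)) \<le> (\<integral>\<^sup>+x. limsup (\<lambda>k. u k x) \<partial>M)"
    by (rule nn_integral_limsup[OF assms(1-4)])
  moreover have "I - J \<le> limsup (\<lambda>k. integral\<^sup>N M (u k))"
    using le J by (intro le_Limsup always_eventually allI) (auto simp: ennreal_minus_le_iff add.commute)
  ultimately have "I - J \<le> (\<integral>\<^sup>+x. u' x \<partial>M)" by simp
  then show ?thesis using J by (simp add: ennreal_minus_le_iff add.commute)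
qed

text \<open>Three limits in a forced order. First the mesh tends to 0 with \<open>L\<close> and
  \<open>m\<close> fixed (\<open>le2\<close>), the truncation level \<open>L\<close> supplying the
  domination. Then \<open>L\<close> tends to infinity (\<open>le3\<close>); its error
  \<open>exp (\<kappa> * T m) / L\<close> may grow with the horizon, so this has to precede the
  limit in \<open>m\<close>. In that last limit the stopped continuous path stays within norm
  \<open>R\<close>, so \<open>exp (c * R)\<close> dominates.\<close>

lemma exit_position_exp_submartingale:
  fixes W :: "real \<Rightarrow> 'w \<Rightarrow> real ^ 'd" and g \<rho> :: "'b \<Rightarrow> real"
  assumes W: "standard_brownian_motion M W" and "0 < \<sigma>" and "0 < c"
    and \<kappa>1: "0 \<le> c * b $ \<iota> + c\<^sup>2 * \<sigma>\<^sup>2 / 2"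
    and ind: "indep_rvs M N X (PiM {0..} (\<lambda>_. borel)) (\<lambda>\<omega>. \<lambda>t\<in>{0..}. W t \<omega>)"
    and g[measurable]: "g \<in> borel_measurable N" and \<rho>[measurable]: "\<rho> \<in> borel_measurable N"
    and \<rho>0: "\<And>x. 0 \<le> \<rho> x" and \<rho>R: "AE \<omega> in M. \<rho> (X \<omega>) \<le> R"
    and fin: "(\<integral>\<^sup>+\<omega>. ennreal (g (X \<omega>)) \<partial>M) < \<infinity>"
  shows "(\<integral>\<^sup>+\<omega>. ennreal (g (X \<omega>)) \<partial>M) \<le> (\<integral>\<^sup>+\<omega>. ennreal (g (X \<omega>)) *
    ennreal (exp (c * exit_position (drifted_path b \<sigma> 0 (\<lambda>t. W t \<omega>)) (ball 0 (\<rho> (X \<omega>))) $ \<iota>)) \<partial>M)"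
proof -
  interpret prob_space M using W by (simp add: standard_brownian_motion_def)
  have X[measurable]: "X \<in> measurable M N" using ind by (simp add: indep_rvs_def)
  define I where "I = (\<integral>\<^sup>+\<omega>. ennreal (g (X \<omega>)) \<partial>M)"
  define \<kappa> where "\<kappa> = 2 * c * b $ \<iota> + (2 * c)\<^sup>2 * \<sigma>\<^sup>2 / 2"
  have \<kappa>2: "0 \<le> \<kappa>"
  proof -
    have "0 \<le> 2 * (c * b $ \<iota> + c\<^sup>2 * \<sigma>\<^sup>2 / 2) + c\<^sup>2 * \<sigma>\<^sup>2"
      by (rule add_nonneg_nonneg[OF mult_nonneg_nonneg[OF _ \<kappa>1]]) simp_all
    also have "\<dots> = \<kappa>" by (simp add: \<kappa>_def power2_eq_square algebra_simps)
    finally show ?thesis .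
  qed
  define z where "z \<omega> = drifted_path b \<sigma> 0 (\<lambda>t. W t \<omega>)" for \<omega>
  have z[measurable]: "0 \<le> t \<Longrightarrow> (\<lambda>\<omega>. z \<omega> t) \<in> borel_measurable M" for t
    unfolding z_def by (rule drifted_path_measurable[OF W])
  have z_cont: "AE \<omega> in M. continuous_on {0..} (z \<omega>)"
  proof -
    have "AE \<omega> in M. continuous_on {0..} (\<lambda>t. W t \<omega>)"
      using W by (simp add: standard_brownian_motion_def)
    then show ?thesis
      unfolding z_def drifted_path_def by eventually_elim (intro continuous_intros)
  qed
  have z_0: "AE \<omega> in M. z \<omega> 0 = 0"
  proof -
    have "AE \<omega> in M. W 0 \<omega> = 0" using W by (simp add: standard_brownian_motion_def)
    then show ?thesis by eventually_elim (simp add: z_def drifted_path_def)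
  qed
  have z_unb: "AE \<omega> in M. \<forall>R. \<exists>t>0. R \<le> norm (z \<omega> t)"
    unfolding z_def by (rule drifted_path_AE_unbounded[OF W \<open>0 < \<sigma>\<close>])
  define r where "r m \<omega> = \<rho> (X \<omega>) * (1 - 1 / real (Suc m))" for m \<omega>
  have r0: "0 \<le> r m \<omega>" and r_le: "r m \<omega> \<le> \<rho> (X \<omega>)" for m \<omega>
    using \<rho>0[of "X \<omega>"] by (auto simp: r_def field_simps)
  define T where "T m = real (Suc m)" for m
  have T: "0 < T m" for m by (simp add: T_def)
  define Z where "Z m k \<omega> =
    stopped_walk (r m \<omega>) (\<lambda>j. z \<omega> (T m / real (Suc k) * real j)) (Suc k)" for m k \<omega>
  define E where "E m \<omega> = z \<omega> (escape_time (r m \<omega>) (T m) (z \<omega>))" for m \<omega>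
  have [measurable]: "(\<lambda>\<omega>. Z m k \<omega> $ \<iota>) \<in> borel_measurable M" for m k
  proof -
    have [measurable]: "(\<lambda>\<omega>. z \<omega> (T m / real (Suc k) * real j)) \<in> borel_measurable M" for j
      by (rule z) (simp add: T_def)
    show ?thesis unfolding Z_def r_def
      by (rule measurable_compose[OF stopped_walk_measurable borel_measurable_nth]) measurable
  qed
  have Z_E: "AE \<omega> in M. (\<lambda>k. Z m k \<omega>) \<longlonglongrightarrow> E m \<omega>" for m
    using z_cont unfolding Z_def E_def by eventually_elim (rule stopped_walk_tendsto_escape[OF _ T])
  have le1: "I \<le> (\<integral>\<^sup>+\<omega>. ennreal (g (X \<omega>)) * ennreal (min L (exp (c * Z m k \<omega> $ \<iota>))) \<partial>M)
      + ennreal (exp (\<kappa> * T m) / L) * I" if "0 < L" for L m k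
  proof -
    have "T m / real (Suc k) > 0" using T by simp
    note le = stopped_walk_exp_truncated_random_radius[OF W this that \<kappa>1 \<kappa>_def \<kappa>2 ind,
        of "\<lambda>x. ennreal (g x)" "\<lambda>x. \<rho> x * (1 - 1 / real (Suc m))" "Suc k"]
    have "\<kappa> * (T m / real (Suc k)) * real (Suc k) = \<kappa> * T m" by (simp del: of_nat_Suc)
    with le show ?thesis by (simp add: I_def Z_def z_def r_def del: of_nat_Suc stopped_walk.simps)
  qed
  have le2: "I \<le> (\<integral>\<^sup>+\<omega>. ennreal (g (X \<omega>)) * ennreal (min L (exp (c * E m \<omega> $ \<iota>))) \<partial>M)
      + ennreal (exp (\<kappa> * T m) / L) * I" if "0 < L" for L m
  proof (rule le_nn_integral_limit_plus[OF _ _ _ _ _ _ le1[OF that]])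
    show "AE \<omega> in M. ennreal (g (X \<omega>)) * ennreal (min L (exp (c * Z m k \<omega> $ \<iota>)))
        \<le> ennreal (g (X \<omega>)) * ennreal L" for k
      by (intro AE_I2 mult_left_mono ennreal_leI) auto
    show "(\<integral>\<^sup>+\<omega>. ennreal (g (X \<omega>)) * ennreal L \<partial>M) < \<infinity>"
      using fin by (simp add: nn_integral_multc ennreal_mult_less_top)
    show "AE \<omega> in M. (\<lambda>k. ennreal (g (X \<omega>)) * ennreal (min L (exp (c * Z m k \<omega> $ \<iota>))))
        \<longlonglongrightarrow> ennreal (g (X \<omega>)) * ennreal (min L (exp (c * E m \<omega> $ \<iota>)))"
      using Z_E[of m] by eventually_elim (intro ennreal_tendsto_cmult tendsto_ennrealI tendsto_intros, simp_all)
    show "ennreal (exp (\<kappa> * T m) / L) * I < \<infinity>"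
      using fin by (simp add: I_def ennreal_mult_less_top)
  qed simp_all
  have le3: "I \<le> (\<integral>\<^sup>+\<omega>. ennreal (g (X \<omega>)) * ennreal (exp (c * E m \<omega> $ \<iota>)) \<partial>M)" for m
  proof (rule ennreal_le_epsilon)
    fix e :: real assume "0 < e"
    obtain i where i: "I = ennreal i" "0 \<le> i" using fin unfolding I_def[symmetric] by (cases I) auto
    define C where "C = exp (\<kappa> * T m)"
    \<comment> \<open>Chosen to make the error \<open>C / L * i\<close> at most \<open>e\<close>;
      \<open>i + 1\<close> replaces \<open>i\<close> because \<open>i\<close> may be 0.\<close>
    define L where "L = C * (i + 1) / e"
    have "0 < C" by (simp add: C_def)
    then have "0 < L" using \<open>0 < e\<close> i by (simp add: L_def)
    have "C / L = e / (i + 1)" using \<open>0 < C\<close> by (simp add: L_def)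
    then have "C / L * i = e * (i / (i + 1))" by simp
    also have "\<dots> \<le> e" using \<open>0 < e\<close> i by (simp add: field_simps)
    finally have "ennreal (C / L) * I \<le> ennreal e"
      using \<open>0 < C\<close> \<open>0 < L\<close> i by (simp add: ennreal_mult[symmetric] ennreal_leI)
    moreover have "(\<integral>\<^sup>+\<omega>. ennreal (g (X \<omega>)) * ennreal (min L (exp (c * E m \<omega> $ \<iota>))) \<partial>M)
        \<le> (\<integral>\<^sup>+\<omega>. ennreal (g (X \<omega>)) * ennreal (exp (c * E m \<omega> $ \<iota>)) \<partial>M)"
      by (intro nn_integral_mono mult_left_mono ennreal_leI) auto
    ultimately show "I \<le> (\<integral>\<^sup>+\<omega>. ennreal (g (X \<omega>)) * ennreal (exp (c * E m \<omega> $ \<iota>)) \<partial>M) + ennreal e"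
      using le2[OF \<open>0 < L\<close>, of m] unfolding C_def by (meson add_mono order_trans)
  qed
  \<comment> \<open>\<open>E m\<close> is measurable only up to a null event; \<open>V m\<close> is a measurable version of \<open>exp (c * E m $ \<iota>)\<close>.\<close>
  define V where "V m \<omega> = limsup (\<lambda>k. ennreal (exp (c * Z m k \<omega> $ \<iota>)))" for m \<omega>
  have [measurable]: "V m \<in> borel_measurable M" for m unfolding V_def by measurable
  have V_E: "AE \<omega> in M. V m \<omega> = ennreal (exp (c * E m \<omega> $ \<iota>))" for m
    using Z_E[of m] unfolding V_def
    by eventually_elim (intro lim_imp_Limsup tendsto_ennrealI tendsto_intros, simp_all)
  have E_le: "AE \<omega> in M. ennreal (exp (c * E m \<omega> $ \<iota>)) \<le> ennreal (exp (c * R))" for m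
    using z_cont z_0 \<rho>R
  proof eventually_elim
    case (elim \<omega>)
    have "norm (E m \<omega>) \<le> r m \<omega>"
      unfolding E_def by (rule norm_escape_le) (use elim r0[of m \<omega>] T[of m] in simp_all)
    then have "E m \<omega> $ \<iota> \<le> R"
      using component_le_norm_cart[of "E m \<omega>" \<iota>] r_le[of m \<omega>] elim(3) by linarith
    then show ?case using \<open>0 < c\<close> by (simp add: ennreal_leI)
  qed
  have "I \<le> (\<integral>\<^sup>+\<omega>. ennreal (g (X \<omega>)) * ennreal (exp (c * exit_position (z \<omega>) (ball 0 (\<rho> (X \<omega>))) $ \<iota>)) \<partial>M) + 0"
  proof (rule le_nn_integral_limit_plus[where u = "\<lambda>m \<omega>. ennreal (g (X \<omega>)) * V m \<omega>"
        and w = "\<lambda>\<omega>. ennreal (g (X \<omega>)) * ennreal (exp (c * R))"])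
    show "AE \<omega> in M. ennreal (g (X \<omega>)) * V m \<omega> \<le> ennreal (g (X \<omega>)) * ennreal (exp (c * R))" for m
      using V_E[of m] E_le[of m] by eventually_elim (simp add: mult_left_mono)
    show "(\<integral>\<^sup>+\<omega>. ennreal (g (X \<omega>)) * ennreal (exp (c * R)) \<partial>M) < \<infinity>"
      using fin by (simp add: nn_integral_multc ennreal_mult_less_top)
    have "AE \<omega> in M. \<forall>m. V m \<omega> = ennreal (exp (c * E m \<omega> $ \<iota>))"
      unfolding AE_all_countable using V_E by blast
    then show "AE \<omega> in M. (\<lambda>m. ennreal (g (X \<omega>)) * V m \<omega>) \<longlonglongrightarrow>
        ennreal (g (X \<omega>)) * ennreal (exp (c * exit_position (z \<omega>) (ball 0 (\<rho> (X \<omega>))) $ \<iota>))"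
      using z_cont z_0 z_unb
    proof eventually_elim
      case (elim \<omega>)
      have "(\<lambda>m. E m \<omega>) \<longlonglongrightarrow> exit_position (z \<omega>) (ball 0 (\<rho> (X \<omega>)))"
        unfolding E_def r_def T_def
        by (rule escape_tendsto_exit_position) (use elim \<rho>0 in auto)
      then show ?case
        unfolding elim(1)[rule_format]
        by (intro ennreal_tendsto_cmult tendsto_ennrealI tendsto_intros, simp_all)
    qed
    show "I \<le> (\<integral>\<^sup>+\<omega>. ennreal (g (X \<omega>)) * V m \<omega> \<partial>M) + 0" for m
    proof -
      have "AE \<omega> in M. ennreal (g (X \<omega>)) * V m \<omega>
          = ennreal (g (X \<omega>)) * ennreal (exp (c * E m \<omega> $ \<iota>))"
        using V_E[of m] by eventually_elim simp
      then have "(\<integral>\<^sup>+\<omega>. ennreal (g (X \<omega>)) * V m \<omega> \<partial>M)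
          = (\<integral>\<^sup>+\<omega>. ennreal (g (X \<omega>)) * ennreal (exp (c * E m \<omega> $ \<iota>)) \<partial>M)"
        by (rule nn_integral_cong_AE)
      then show ?thesis using le3 by simp
    qed
  qed simp_all
  then show ?thesis by (simp add: I_def z_def)
qed

text \<open>One null event serves all radii, so \<open>r\<close> may afterwards be replaced by the
  random radius of a step.\<close>

lemma exit_position_norm_AE:
  fixes W :: "real \<Rightarrow> 'w \<Rightarrow> real ^ 'd"
  assumes W: "standard_brownian_motion M W" and "0 < \<sigma>"
  shows "AE \<omega> in M. \<forall>r\<ge>0. norm (exit_position (drifted_path b \<sigma> 0 (\<lambda>t. W t \<omega>)) (ball 0 r)) = r"
proof -
  have "AE \<omega> in M. W 0 \<omega> = 0" "AE \<omega> in M. continuous_on {0..} (\<lambda>t. W t \<omega>)"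
    using W by (simp_all add: standard_brownian_motion_def)
  with drifted_path_AE_unbounded[OF assms, of b] show ?thesis
  proof eventually_elim
    case (elim \<omega>)
    have "continuous_on {0..} (drifted_path b \<sigma> 0 (\<lambda>t. W t \<omega>))"
      unfolding drifted_path_def using elim by (intro continuous_intros)
    then show ?case
      using elim by (auto intro!: norm_exit_position simp: drifted_path_def)
  qed
qed

text \<open>A segment that leaves \<open>closure D\<close> meets the boundary at some
  \<open>p\<close> different from its end \<open>y'\<close>, hence strictly closer to
  \<open>y\<close> than \<open>y'\<close> is, which contradicts the distance bound.\<close>

lemma mem_closure_if_dist_le_infdist_frontier:
  fixes D :: "'a::real_normed_vector set"
  assumes "y \<in> closure D" and "dist y y' \<le> infdist y (frontier D)"
  shows "y' \<in> closure D"
proof (rule ccontr)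
  assume "y' \<notin> closure D"
  then have "closed_segment y y' \<inter> closure D \<noteq> {}" "closed_segment y y' - closure D \<noteq> {}"
    using assms(1) by auto
  then have "closed_segment y y' \<inter> frontier (closure D) \<noteq> {}"
    by (intro connected_Int_frontier) auto
  then obtain p where p: "p \<in> closed_segment y y'" "p \<in> frontier (closure D)" by blast
  then have pF: "p \<in> frontier D" and "p \<in> closure D"
    using interior_mono[OF closure_subset, of D] by (auto simp: frontier_def)
  with \<open>y' \<notin> closure D\<close> have "p \<noteq> y'" by auto
  obtain u where u: "p = (1 - u) *\<^sub>R y + u *\<^sub>R y'" "0 \<le> u" "u \<le> 1"
    using p(1) by (auto simp: in_segment)
  have "y \<noteq> y'" using assms(1) \<open>y' \<notin> closure D\<close> by auto
  have "p - y = u *\<^sub>R (y' - y)" using u(1) by (simp add: algebra_simps)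
  then have "dist y p = u * dist y y'"
    using u(2) by (simp add: dist_norm norm_minus_commute[of y])
  moreover have "u < 1" using \<open>p \<noteq> y'\<close> u by (cases "u = 1") auto
  ultimately have "dist y p < dist y y'" using \<open>y \<noteq> y'\<close> by simp
  also have "\<dots> \<le> dist y p" using assms(2) infdist_le[OF pF, of y] by linarith
  finally show False by simp
qed

subsection \<open>The exit sequence\<close>

text \<open>As \<open>\<theta> \<le> 1\<close>, no step is longer than the distance to the boundary.
  For \<open>\<theta> = 1\<close> the boundary can be reached, hence \<open>closure D\<close> and
  not \<open>D\<close>. Writing \<open>Suc n\<close> skips the arbitrary value
  \<open>Y 0\<close>.\<close>

lemma exit_sequence_closure_AE:
  fixes W :: "nat \<Rightarrow> real \<Rightarrow> 'w \<Rightarrow> real ^ 'd"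
  assumes ex: "exit_sequence M b \<sigma> \<theta> D x W Y" and "0 < \<sigma>" and "0 \<le> \<theta>" "\<theta> \<le> 1" and "x \<in> closure D"
  shows "AE \<omega> in M. \<forall>n. Y (Suc n) \<omega> \<in> closure D \<and>
    norm (Y (Suc (Suc n)) \<omega> - Y (Suc n) \<omega>) = \<theta> * infdist (Y (Suc n) \<omega>) (frontier D)"
proof -
  have step: "AE \<omega> in M. norm (Y (Suc (Suc n)) \<omega> - Y (Suc n) \<omega>)
      = \<theta> * infdist (Y (Suc n) \<omega>) (frontier D)" for n
  proof -
    have W: "standard_brownian_motion M (W (Suc n))"
      and Y: "AE \<omega> in M. Y (Suc (Suc n)) \<omega> =
         exit_position (drifted_path b \<sigma> (Y (Suc n) \<omega>) (\<lambda>t. W (Suc n) t \<omega>))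
             (ball (Y (Suc n) \<omega>) (\<theta> * infdist (Y (Suc n) \<omega>) (frontier D)))"
      using ex by (simp_all add: exit_sequence_def)
    from Y exit_position_norm_AE[OF W \<open>0 < \<sigma>\<close>, of b] show ?thesis
    proof eventually_elim
      case (elim \<omega>)
      show ?case
        unfolding elim(1) exit_position_drifted_path[of b \<sigma> "Y (Suc n) \<omega>"]
        using elim(2) \<open>0 \<le> \<theta>\<close> by (simp add: infdist_nonneg)
    qed
  qed
  have "AE \<omega> in M. Y 1 \<omega> = x" using ex by (simp add: exit_sequence_def)
  moreover have "AE \<omega> in M. \<forall>n. norm (Y (Suc (Suc n)) \<omega> - Y (Suc n) \<omega>)
      = \<theta> * infdist (Y (Suc n) \<omega>) (frontier D)"
    unfolding AE_all_countable using step by blast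
  ultimately show ?thesis
  proof eventually_elim
    case (elim \<omega>)
    have "Y (Suc n) \<omega> \<in> closure D" for n
    proof (induction n)
      case 0
      then show ?case using elim(1) \<open>x \<in> closure D\<close> by simp
    next
      case (Suc n)
      have "\<theta> * infdist (Y (Suc n) \<omega>) (frontier D) \<le> 1 * infdist (Y (Suc n) \<omega>) (frontier D)"
        using \<open>\<theta> \<le> 1\<close> by (intro mult_right_mono infdist_nonneg)
      then have "dist (Y (Suc n) \<omega>) (Y (Suc (Suc n)) \<omega>) \<le> infdist (Y (Suc n) \<omega>) (frontier D)"
        using elim(2) by (simp add: dist_norm norm_minus_commute)
      with Suc show ?case by (rule mem_closure_if_dist_le_infdist_frontier)
    qed
    with elim(2) show ?case by blast
  qed
qed

lemma exit_sequence_exp_convergent_AE: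
  fixes W :: "nat \<Rightarrow> real \<Rightarrow> 'w \<Rightarrow> real ^ 'd"
  assumes ex: "exit_sequence M b \<sigma> \<theta> D x W Y" and "prob_space M"
    and "0 < \<sigma>" and "0 \<le> \<theta>" "\<theta> \<le> 1" and "x \<in> closure D" and "bounded D"
    and "0 < c" and \<kappa>: "0 \<le> c * b $ \<iota> + c\<^sup>2 * \<sigma>\<^sup>2 / 2"
  shows "AE \<omega> in M. convergent (\<lambda>n. exp (c * Y (Suc n) \<omega> $ \<iota>))"
proof -
  interpret prob_space M by fact
  note closure_AE = exit_sequence_closure_AE[OF ex \<open>0 < \<sigma>\<close> \<open>0 \<le> \<theta>\<close> \<open>\<theta> \<le> 1\<close> \<open>x \<in> closure D\<close>]
  obtain B where B: "\<And>y. y \<in> closure D \<Longrightarrow> norm y \<le> B"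
    using bounded_closure[OF \<open>bounded D\<close>] by (auto simp: bounded_iff)
  obtain R where R: "\<And>y. y \<in> closure D \<Longrightarrow> \<theta> * infdist y (frontier D) \<le> R"
  proof -
    have "bounded ((\<lambda>y. \<theta> * infdist y (frontier D)) ` closure D)"
      by (intro compact_imp_bounded compact_continuous_image continuous_intros)
        (simp add: compact_closure \<open>bounded D\<close>)
    then obtain R where "\<forall>r\<in>(\<lambda>y. \<theta> * infdist y (frontier D)) ` closure D. norm r \<le> R"
      by (auto simp: bounded_iff)
    then show thesis by (intro that[of R]) force
  qed
  define K where "K = exp (c * B)"
  \<comment> \<open>The convergence lemma asks for bounds at every point of the space, while
    \<open>Y\<close> stays in \<open>closure D\<close> only almost surely. The level
    \<open>K\<close> is so large that the truncation changes nothing on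
    \<open>closure D\<close>.\<close>
  define f where "f y = min K (exp (c * y $ \<iota>))" for y :: "real ^ 'd"
  have f: "0 \<le> f y" "f y \<le> K" for y by (auto simp: f_def K_def)
  have f_eq: "f y = exp (c * y $ \<iota>)" if "y \<in> closure D" for y
  proof -
    have "y $ \<iota> \<le> B" using component_le_norm_cart[of y \<iota>] B[OF that] by linarith
    then show ?thesis using \<open>0 < c\<close> by (simp add: f_def K_def)
  qed
  have [measurable]: "f \<in> borel_measurable borel" unfolding f_def by measurable
  have Y[measurable]: "Y (Suc n) \<in> borel_measurable M" for n
    using ex by (simp add: exit_sequence_def)
  define S where "S n \<omega> = f (Y (Suc n) \<omega>)" for n \<omega>
  have S[measurable]: "S n \<in> borel_measurable M" for n unfolding S_def by measurable
  have "AE \<omega> in M. convergent (\<lambda>n. S n \<omega>)"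
  proof (rule bounded_submartingale_AE_convergent[OF S])
    fix n C and g :: "(nat \<Rightarrow> real) \<Rightarrow> real"
    assume g[measurable]: "g \<in> borel_measurable (PiM {..n} (\<lambda>_. borel))"
    assume "\<And>\<omega>. \<omega> \<in> space M \<Longrightarrow> 0 \<le> g (\<lambda>k\<in>{..n}. S k \<omega>) \<and> g (\<lambda>k\<in>{..n}. S k \<omega>) \<le> C"
    then have g0: "0 \<le> g (\<lambda>k\<in>{..n}. S k \<omega>)" and gC: "g (\<lambda>k\<in>{..n}. S k \<omega>) \<le> C"
      if "\<omega> \<in> space M" for \<omega> using that by auto
    let ?N = "PiM {1..Suc n} (\<lambda>_. borel :: (real ^ 'd) measure)"
    let ?X = "\<lambda>\<omega>. \<lambda>k\<in>{1..Suc n}. Y k \<omega>"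
    have W: "standard_brownian_motion M (W (Suc n))"
      and ind: "indep_rvs M ?N ?X (PiM {0..} (\<lambda>_. borel)) (\<lambda>\<omega>. \<lambda>t\<in>{0..}. W (Suc n) t \<omega>)"
      and step: "AE \<omega> in M. Y (Suc (Suc n)) \<omega> =
         exit_position (drifted_path b \<sigma> (Y (Suc n) \<omega>) (\<lambda>t. W (Suc n) t \<omega>))
             (ball (Y (Suc n) \<omega>) (\<theta> * infdist (Y (Suc n) \<omega>) (frontier D)))"
      using ex by (simp_all add: exit_sequence_def)
    have [measurable]: "(\<lambda>y. y (Suc k)) \<in> borel_measurable ?N" if "k \<le> n" for k
      using that by (intro measurable_component_singleton) auto
    \<comment> \<open>The new value of \<open>S\<close> is almost surely the old one times the
      exponential of the exit increment, so the old value is absorbed into the weight and the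
      one-step inequality applies to the increment alone.\<close>
    define G where "G y = g (\<lambda>k\<in>{..n}. f (y (Suc k))) * f (y (Suc n))" for y
    have [measurable]: "(\<lambda>y. \<lambda>k\<in>{..n}. f (y (Suc k))) \<in> measurable ?N (PiM {..n} (\<lambda>_. borel))"
      by (rule measurable_restrict) measurable
    have G: "G \<in> borel_measurable ?N" unfolding G_def by measurable
    have G_X: "G (?X \<omega>) = g (\<lambda>k\<in>{..n}. S k \<omega>) * S n \<omega>" for \<omega>
    proof -
      have "(\<lambda>k\<in>{..n}. f (?X \<omega> (Suc k))) = (\<lambda>k\<in>{..n}. S k \<omega>)"
        by (auto simp: S_def restrict_def)
      then show ?thesis by (simp add: G_def S_def)
    qed
    have gS[measurable]: "(\<lambda>\<omega>. g (\<lambda>k\<in>{..n}. S k \<omega>)) \<in> borel_measurable M" by measurable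
    have int: "integrable M (\<lambda>\<omega>. g (\<lambda>k\<in>{..n}. S k \<omega>) * S m \<omega>)" for m
    proof (rule integrable_const_bound[of _ "C * K"])
      show "AE \<omega> in M. norm (g (\<lambda>k\<in>{..n}. S k \<omega>) * S m \<omega>) \<le> C * K"
      proof (rule AE_I2)
        fix \<omega> assume \<omega>: "\<omega> \<in> space M"
        show "norm (g (\<lambda>k\<in>{..n}. S k \<omega>) * S m \<omega>) \<le> C * K"
          using g0[OF \<omega>] gC[OF \<omega>] f[of "Y (Suc m) \<omega>"] by (simp add: abs_mult S_def mult_mono)
      qed
    qed measurable
    define \<rho> where "\<rho> y = \<theta> * infdist (y (Suc n)) (frontier D)" for y :: "nat \<Rightarrow> real ^ 'd"
    have "(\<lambda>y. infdist y (frontier D)) \<in> borel_measurable borel"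
      by (intro borel_measurable_continuous_onI continuous_intros)
    from _ this have [measurable]: "(\<lambda>y. infdist (y (Suc n)) (frontier D)) \<in> borel_measurable ?N"
      by (rule measurable_compose) measurable
    have \<rho>: "\<rho> \<in> borel_measurable ?N" unfolding \<rho>_def by measurable
    have \<rho>0: "0 \<le> \<rho> y" for y using \<open>0 \<le> \<theta>\<close> by (simp add: \<rho>_def infdist_nonneg)
    have \<rho>_X: "\<rho> (?X \<omega>) = \<theta> * infdist (Y (Suc n) \<omega>) (frontier D)" for \<omega> by (simp add: \<rho>_def)
    have \<rho>R: "AE \<omega> in M. \<rho> (?X \<omega>) \<le> R"
      unfolding \<rho>_X using closure_AE by eventually_elim (simp add: R)
    have nn: "(\<integral>\<^sup>+\<omega>. ennreal (g (\<lambda>k\<in>{..n}. S k \<omega>) * S m \<omega>) \<partial>M)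
        = ennreal (expectation (\<lambda>\<omega>. g (\<lambda>k\<in>{..n}. S k \<omega>) * S m \<omega>))" for m
      using int g0 f by (intro nn_integral_eq_integral) (auto intro!: AE_I2 mult_nonneg_nonneg simp: S_def)
    have "(\<integral>\<^sup>+\<omega>. ennreal (G (?X \<omega>)) \<partial>M) < \<infinity>" unfolding G_X nn by simp
    then have "(\<integral>\<^sup>+\<omega>. ennreal (G (?X \<omega>)) \<partial>M) \<le> (\<integral>\<^sup>+\<omega>. ennreal (G (?X \<omega>)) * ennreal (exp (c *
        exit_position (drifted_path b \<sigma> 0 (\<lambda>t. W (Suc n) t \<omega>)) (ball 0 (\<rho> (?X \<omega>))) $ \<iota>)) \<partial>M)"
      by (rule exit_position_exp_submartingale[where X = ?X and N = ?N and g = G and \<rho> = \<rho>,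
            OF W \<open>0 < \<sigma>\<close> \<open>0 < c\<close> \<kappa> ind G \<rho> \<rho>0 \<rho>R])
    also have "\<dots> = (\<integral>\<^sup>+\<omega>. ennreal (g (\<lambda>k\<in>{..n}. S k \<omega>) * S (Suc n) \<omega>) \<partial>M)"
    proof (rule nn_integral_cong_AE)
      show "AE \<omega> in M. ennreal (G (?X \<omega>)) * ennreal (exp (c *
          exit_position (drifted_path b \<sigma> 0 (\<lambda>t. W (Suc n) t \<omega>)) (ball 0 (\<rho> (?X \<omega>))) $ \<iota>))
        = ennreal (g (\<lambda>k\<in>{..n}. S k \<omega>) * S (Suc n) \<omega>)"
        using step closure_AE AE_space
      proof eventually_elim
        case (elim \<omega>)
        let ?e = "exit_position (drifted_path b \<sigma> 0 (\<lambda>t. W (Suc n) t \<omega>)) (ball 0 (\<rho> (?X \<omega>)))"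
        have "Y (Suc (Suc n)) \<omega> = Y (Suc n) \<omega> + ?e"
          unfolding \<rho>_X elim(1) by (rule exit_position_drifted_path)
        moreover have "S n \<omega> = exp (c * Y (Suc n) \<omega> $ \<iota>)" "S (Suc n) \<omega> = exp (c * Y (Suc (Suc n)) \<omega> $ \<iota>)"
          using elim(2) by (simp_all add: S_def f_eq)
        ultimately have "S (Suc n) \<omega> = S n \<omega> * exp (c * ?e $ \<iota>)"
          by (simp add: mult_exp_exp distrib_left)
        then have eq: "g (\<lambda>k\<in>{..n}. S k \<omega>) * S (Suc n) \<omega> = G (?X \<omega>) * exp (c * ?e $ \<iota>)"
          unfolding G_X by (simp only: mult.assoc)
        have "0 \<le> G (?X \<omega>)"
          unfolding G_X using g0[OF elim(3)] f by (simp add: S_def)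
        then show ?case unfolding eq by (simp add: ennreal_mult)
      qed
    qed
    finally show "expectation (\<lambda>\<omega>. g (\<lambda>k\<in>{..n}. S k \<omega>) * S n \<omega>)
        \<le> expectation (\<lambda>\<omega>. g (\<lambda>k\<in>{..n}. S k \<omega>) * S (Suc n) \<omega>)"
      unfolding G_X nn using g0 f
      by (subst (asm) ennreal_le_iff) (auto intro!: integral_nonneg_AE AE_I2 mult_nonneg_nonneg simp: S_def)
  qed (use f in \<open>auto simp: S_def\<close>)
  with closure_AE show ?thesis
    by eventually_elim (simp add: S_def f_eq)
qed

theorem lemma3p2:
  fixes a \<sigma> \<theta> :: real and b x :: "real ^ 'd" and D :: "(real ^ 'd) set"
    and M :: "'w measure"
    and W :: "nat \<Rightarrow> real \<Rightarrow> 'w \<Rightarrow> real ^ 'd" and Y :: "nat \<Rightarrow> 'w \<Rightarrow> real ^ 'd"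
  assumes "a > 0" and "\<sigma> = sqrt (2 * a)" and "0 < \<theta>" and "\<theta> \<le> 1"
    and "D \<noteq> {}" and "bounded D" and "open D" and "x \<in> D"
    and "prob_space M"
    and "exit_sequence M b \<sigma> \<theta> D x W Y"
  shows "\<exists>Y_inf \<in> borel_measurable M.
           AE \<omega> in M. Y_inf \<omega> \<in> frontier D \<and> (\<lambda>n. Y n \<omega>) \<longlonglongrightarrow> Y_inf \<omega>"
proof -
  have "0 < \<sigma>" using assms(1,2) by simp
  have \<sigma>2: "\<sigma>\<^sup>2 = 2 * a" using assms(1,2) by simp
  have x: "x \<in> closure D" using \<open>x \<in> D\<close> closure_subset by blast
  have \<theta>0: "0 \<le> \<theta>" using \<open>0 < \<theta>\<close> by simp
  \<comment> \<open>\<open>infdist\<close> to the empty set is 0, so the boundary must be known to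
    be nonempty before a vanishing distance places the limit on it. It is nonempty because
    \<open>D\<close> is neither empty nor, being bounded, the whole space.\<close>
  have F: "closed (frontier D)" "frontier D \<noteq> {}"
    using assms(5,6) not_bounded_UNIV by (auto simp: frontier_eq_empty)
  note closure_AE = exit_sequence_closure_AE[OF assms(10) \<open>0 < \<sigma>\<close> \<theta>0 assms(4) x]
  have [measurable]: "Y (Suc n) \<in> borel_measurable M" for n
    using assms(10) by (simp add: exit_sequence_def)
  \<comment> \<open>With \<open>\<sigma>\<^sup>2 = 2 * a\<close> the rate is
    \<open>c * (b $ \<iota> + a * c)\<close>, nonnegative for all coordinates at once when
    \<open>a * c\<close> is at least \<open>norm b\<close>; the added 1 keeps \<open>c\<close>
    positive for \<open>b = 0\<close>.\<close>
  define c where "c = norm b / a + 1"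
  have "0 < c" using \<open>a > 0\<close> by (simp add: c_def add_nonneg_pos)
  have \<kappa>: "0 \<le> c * b $ \<iota> + c\<^sup>2 * \<sigma>\<^sup>2 / 2" for \<iota>
  proof -
    have "norm b \<le> a * c" using \<open>a > 0\<close> by (simp add: c_def field_simps)
    then have "0 \<le> b $ \<iota> + a * c" using component_le_norm_cart[of b \<iota>] by linarith
    then have "0 \<le> c * (b $ \<iota> + a * c)" using \<open>0 < c\<close> by simp
    then show ?thesis by (simp add: \<sigma>2 power2_eq_square[of c] algebra_simps)
  qed
  \<comment> \<open>Where the sequence diverges, \<open>lim\<close> takes one fixed unspecified
    value, which keeps \<open>Y_inf\<close> measurable on the whole space.\<close>
  define Y_inf where "Y_inf \<omega> = lim (\<lambda>n. Y (Suc n) \<omega>)" for \<omega>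
  have "AE \<omega> in M. \<forall>\<iota>\<in>UNIV. convergent (\<lambda>n. exp (c * Y (Suc n) \<omega> $ \<iota>))"
    by (rule AE_finite_allI)
      (auto intro!: exit_sequence_exp_convergent_AE[OF assms(10,9) \<open>0 < \<sigma>\<close> \<theta>0 assms(4) x assms(6) \<open>0 < c\<close>] \<kappa>)
  with closure_AE have "AE \<omega> in M. Y_inf \<omega> \<in> frontier D \<and> (\<lambda>n. Y n \<omega>) \<longlonglongrightarrow> Y_inf \<omega>"
  proof eventually_elim
    case (elim \<omega>)
    obtain B where B: "\<And>y. y \<in> closure D \<Longrightarrow> norm y \<le> B"
      using bounded_closure[OF \<open>bounded D\<close>] by (auto simp: bounded_iff)
    have "\<exists>l. \<forall>\<iota>. (\<lambda>n. Y (Suc n) \<omega> $ \<iota>) \<longlonglongrightarrow> l \<iota>"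
    proof (rule choice, rule allI)
      fix \<iota>
      obtain l where l: "(\<lambda>n. exp (c * Y (Suc n) \<omega> $ \<iota>)) \<longlonglongrightarrow> l"
        using elim(2) by (auto simp: convergent_def)
      \<comment> \<open>A positive lower bound keeps the limit \<open>l\<close> away from 0, so that
        the logarithm is continuous there and convergence passes back to the coordinate.\<close>
      have "exp (- (c * B)) \<le> exp (c * Y (Suc n) \<omega> $ \<iota>)" for n
      proof -
        have "- B \<le> Y (Suc n) \<omega> $ \<iota>"
          using component_le_norm_cart[of "Y (Suc n) \<omega>" \<iota>] B[of "Y (Suc n) \<omega>"] elim(1) by force
        from mult_left_mono[OF this, of c] show ?thesis using \<open>0 < c\<close> by simp
      qed
      then have "exp (- (c * B)) \<le> l" by (intro LIMSEQ_le_const[OF l]) auto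
      then have "l > 0" by (rule less_le_trans[OF exp_gt_zero])
      then have "(\<lambda>n. ln (exp (c * Y (Suc n) \<omega> $ \<iota>)) / c) \<longlonglongrightarrow> ln l / c"
        using l \<open>0 < c\<close> by (intro tendsto_intros) auto
      then show "\<exists>l. (\<lambda>n. Y (Suc n) \<omega> $ \<iota>) \<longlonglongrightarrow> l" using \<open>0 < c\<close> by auto
    qed
    then obtain l where l: "\<And>\<iota>. (\<lambda>n. Y (Suc n) \<omega> $ \<iota>) \<longlonglongrightarrow> l \<iota>" by blast
    have "(\<lambda>n. Y (Suc n) \<omega>) \<longlonglongrightarrow> (\<chi> \<iota>. l \<iota>)"
      by (rule vec_tendstoI) (simp add: l)
    then have lim: "(\<lambda>n. Y (Suc n) \<omega>) \<longlonglongrightarrow> Y_inf \<omega>" unfolding Y_inf_def by (simp add: limI)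
    have "(\<lambda>n. norm (Y (Suc (Suc n)) \<omega> - Y (Suc n) \<omega>)) \<longlonglongrightarrow> norm (Y_inf \<omega> - Y_inf \<omega>)"
      by (intro tendsto_intros lim LIMSEQ_Suc[OF lim])
    moreover have "(\<lambda>n. norm (Y (Suc (Suc n)) \<omega> - Y (Suc n) \<omega>)) \<longlonglongrightarrow> \<theta> * infdist (Y_inf \<omega>) (frontier D)"
      using elim(1) by (simp add: tendsto_intros lim)
    ultimately have "infdist (Y_inf \<omega>) (frontier D) = 0"
      using LIMSEQ_unique \<open>0 < \<theta>\<close> by fastforce
    then have "Y_inf \<omega> \<in> frontier D" using in_closed_iff_infdist_zero[OF F] by blast
    then show ?case using LIMSEQ_imp_Suc[OF lim] by blast
  qed
  moreover have "Y_inf \<in> borel_measurable M" unfolding Y_inf_def by measurable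
  ultimately show ?thesis by blast
qed

end
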